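(* Let $\gamma>0$, $C\in\mathbb{R}^{p\times n}$, $D\in\mathbb{R}^{p\times m}$, and write $C_{Y,L}:=CY+DL$. Let $$\Theta_{\mathcal{H}_\infty}:=\{(Y,L)\in\mathbb{S}^n\times\mathbb{R}^{m\times n}\mid Y-C_{Y,L}^\top C_{Y,L}>0\}$$ and let $M_{\mathcal{H}_\infty}:\Theta_{\mathcal{H}_\infty}\to\mathbb{S}^{n,n+m}$ be $$M_{\mathcal{H}_\infty}(Y,L):=\begin{bmatrix}Y-\frac{1}{\gamma^2}I&0\\ 0&-\begin{bmatrix}Y\\ L\end{bmatrix}(Y-C_{Y,L}^\top C_{Y,L})^{-1}\begin{bmatrix}Y\\ L\end{bmatrix}^\top\end{bmatrix}.$$ Let $Q\in\mathbb{S}^{n,n+m}$ be the data-dependent matrix defined in the context. The data $\mathcal{D}=(U_-,X)$ are informative for $M_{\mathcal{H}_\infty}$-control with respect to $\mathcal{W}_{\mathrm F}(\Phi)$ if and only if there exist matrices $Y\in\mathbb{S}^n$ and $L\in\mathbb{R}^{m\times n}$ and scalars $\alpha\ge0$ and $\beta>0$ such that $$\begin{bmatrix}Y-\frac{1}{\gamma^2}I-\beta I&0&0&0&0\\ 0&0&0&Y&0\\ 0&0&0&L&0\\ 0&Y&L^\top&Y&C_{Y,L}^\top\\ 0&0&0&C_{Y,L}&I\end{bmatrix}-\alpha\begin{bmatrix}Q&0\\ 0&0\end{bmatrix}\ge0,\qquad(\ast)$$ $$\begin{bmatrix}Y&C_{Y,L}^\top\\ C_{Y,L}&I\end{bmatrix}>0.\qquad(\ast\ast)$$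 Moreover, if $Y$ and $L$ satisfy $(\ast)$ and $(\ast\ast)$ (for some $\alpha\ge0$, $\beta>0$), then $K:=LY^{-1}$ is such that $A+BK$ is stable and $\|G(z)\|_{\mathcal{H}_\infty}<\gamma$ for all $(A,B)\in\Sigma_{\mathcal D}(\mathcal{W}_{\mathrm F}(\Phi))$, where $G(z)=(C+DK)(zI-(A+BK))^{-1}$.
   Context: Notation. All matrices are real. $\mathbb{S}^n$: symmetric $n\times n$ matrices; $\ge,>,\le,<$ between symmetric matrices refer to (semi)definiteness. $\mathbb{S}^{p,q}$: symmetric $(p+q)\times(p+q)$ matrices partitioned as $\Pi=\begin{bmatrix}\Pi_{11}&\Pi_{12}\\ \Pi_{21}&\Pi_{22}\end{bmatrix}$ with $\Pi_{11}\in\mathbb{S}^p$, $\Pi_{22}\in\mathbb{S}^q$. $Y^\dagger$ is the Moore-Penrose pseudoinverse, $\otimes$ the Kronecker product, $\operatorname{vec}(Y)$ the column-stacking vectorization. $\Pi|\Pi_{22}:=\Pi_{11}-\Pi_{12}\Pi_{22}^{\dagger}\Pi_{21}$, and $\mathbf{\Pi}_{p,q}:=\{\Pi\in\mathbb{S}^{p,q}\mid \Pi_{22}\le 0,\ \ker\Pi_{22}\subseteq\ker\Pi_{12},\ \Pi|\Pi_{22}\ge 0\}$. A square matrix is stable if all its eigenvalues lie in the open unit disc; $\|\cdot\|_{\mathcal{H}_\infty}$ is the (discrete-time) $\mathcal{H}_\infty$ norm of a transfer matrix. Data and noise model. Let $n,m,p,T$ be positive integers. The data $\mathcal{D}=(U_-,X)$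 consist of $U_-=[u(0)\ \cdots\ u(T-1)]\in\mathbb{R}^{m\times T}$ and $X=[x(0)\ \cdots\ x(T)]\in\mathbb{R}^{n\times(T+1)}$; put $X_-=[x(0)\ \cdots\ x(T-1)]$, $X_+=[x(1)\ \cdots\ x(T)]$. Let $\Phi\in\mathbf{\Pi}_{1,nT}$ be given, with $\Phi_{22}=\phi\otimes I_n$ for some $\phi\in\mathbb{S}^T$, and let $$\mathcal{W}_{\mathrm F}(\Phi):=\Big\{W\in\mathbb{R}^{n\times T}\ \Big|\ \begin{bmatrix}1\\ \operatorname{vec}(W)\end{bmatrix}^{\top}\Phi\begin{bmatrix}1\\ \operatorname{vec}(W)\end{bmatrix}\ge 0\Big\}.$$ The set of data-compatible systems is $\Sigma_{\mathcal D}(\mathcal{W}_{\mathrm F}(\Phi)):=\{(A,B)\in\mathbb{R}^{n\times n}\times\mathbb{R}^{n\times m}\mid X_+=AX_-+BU_-+W\text{ for some }W\in\mathcal{W}_{\mathrm F}(\Phi)\}$. The data are generated by a true (unknown) system $(A_s,B_s)$ with noise matrix in $\mathcal{W}_{\mathrm F}(\Phi)$, i.e. $(A_s,B_s)\in\Sigma_{\mathcal D}(\mathcal{W}_{\mathrm F}(\Phi))$. The performance output is $y(t)=Cx(t)+Du(t)$, and $G(z)$ is the transfer matrix from the noise $w$ to $y$ of the closed loop of $x(t+1)=Ax(t)+Bu(t)+w(t)$ with $u=Kx$. Informativity. For a set $\Theta$ and $M:\Theta\to\mathbb{S}^{n,n+m}$ with $M_{22}(\theta)\le0$ for all $\theta$,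 the data are informative for $M$-control with respect to $\mathcal{W}_{\mathrm F}(\Phi)$ if there exists $\theta\in\Theta$ such that $$\begin{bmatrix}I\\ A^\top\\ B^\top\end{bmatrix}^{\top}M(\theta)\begin{bmatrix}I\\ A^\top\\ B^\top\end{bmatrix}>0\quad\text{for all }(A,B)\in\Sigma_{\mathcal D}(\mathcal{W}_{\mathrm F}(\Phi)).$$ The matrices $N$ and $Q$. Let $$E:=\begin{bmatrix}1&0\\ \operatorname{vec}(X_+)&-\begin{bmatrix}X_-\\ U_-\end{bmatrix}^{\top}\otimes I_n\end{bmatrix},\qquad N:=E^{\top}\Phi E\in\mathbb{S}^{1,n(n+m)},$$ $$Q_{22}:=\begin{bmatrix}X_-\\ U_-\end{bmatrix}\phi\begin{bmatrix}X_-\\ U_-\end{bmatrix}^{\top},\qquad Q:=\begin{bmatrix}(N|N_{22})I_n+Q_{12}Q_{22}^{\dagger}Q_{21}&Q_{12}\\ Q_{21}&Q_{22}\end{bmatrix}\in\mathbb{S}^{n,n+m},$$ where $Q_{12}\in\mathbb{R}^{n\times(n+m)}$ is determined by $\operatorname{vec}(Q_{12})=N_{21}$ and $Q_{21}=Q_{12}^\top$. In the $5\times5$ block inequality of the claim the diagonal blocks have sizes $n,n,m,n,p$, and $Q$ is padded with zeros in the last $n+p$ rows and columns. *)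

theory Defs
  imports "HOL-Analysis.Analysis"
begin

section \<open>Block matrices\<close>

text \<open>A dimension is a finite index type.  A block partition of an index range is a sum type
  (\<^typ>\<open>1\<close> for a block of size one), and the Kronecker product is indexed by pairs.\<close>

definition block_mat ::
  "'a^'c^'r \<Rightarrow> 'a^'d^'r \<Rightarrow> 'a^'c^'s \<Rightarrow> 'a^'d^'s \<Rightarrow> 'a^('c + 'd)^('r + 's)" where
  "block_mat A B C D = (\<chi> i j.
     (case i of
        Inl r \<Rightarrow> (case j of Inl c \<Rightarrow> A $ r $ c | Inr d \<Rightarrow> B $ r $ d)
      | Inr s \<Rightarrow> (case j of Inl c \<Rightarrow> C $ s $ c | Inr d \<Rightarrow> D $ s $ d)))"

definition stack :: "'a^'c^'r \<Rightarrow> 'a^'c^'s \<Rightarrow> 'a^'c^('r + 's)" where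
  "stack A B = (\<chi> i. case i of Inl r \<Rightarrow> A $ r | Inr s \<Rightarrow> B $ s)"

definition beside :: "'a^'c^'r \<Rightarrow> 'a^'d^'r \<Rightarrow> 'a^('c + 'd)^'r" where
  "beside A B = (\<chi> i j. case j of Inl c \<Rightarrow> A $ i $ c | Inr d \<Rightarrow> B $ i $ d)"

definition blk11 :: "'a^('c::finite + 'd::finite)^('r::finite + 's::finite) \<Rightarrow> 'a^'c^'r" where
  "blk11 M = (\<chi> i j. M $ Inl i $ Inl j)"

definition blk12 :: "'a^('c::finite + 'd::finite)^('r::finite + 's::finite) \<Rightarrow> 'a^'d^'r" where
  "blk12 M = (\<chi> i j. M $ Inl i $ Inr j)"

definition blk21 :: "'a^('c::finite + 'd::finite)^('r::finite + 's::finite) \<Rightarrow> 'a^'c^'s" where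
  "blk21 M = (\<chi> i j. M $ Inr i $ Inl j)"

definition blk22 :: "'a^('c::finite + 'd::finite)^('r::finite + 's::finite) \<Rightarrow> 'a^'d^'s" where
  "blk22 M = (\<chi> i j. M $ Inr i $ Inr j)"

definition kronecker :: "real^'c^'r \<Rightarrow> real^'d^'s \<Rightarrow> real^('c \<times> 'd)^('r \<times> 's)" where
  "kronecker A B = (\<chi> i j. A $ fst i $ fst j * B $ snd i $ snd j)"

text \<open>Column stacking: the entry in row \<open>i\<close> and column \<open>j\<close> gets index \<open>(j, i)\<close>, so that
  \<open>vec (A X B) = (B\<^sup>T \<otimes> A) vec X\<close> holds with the pair indexing of \<^const>\<open>kronecker\<close>.\<close>

definition vectorize :: "real^'c^'r \<Rightarrow> real^('c \<times> 'r)" where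
  "vectorize W = (\<chi> k. W $ snd k $ fst k)"

definition unvectorize :: "real^('c \<times> 'r) \<Rightarrow> real^'c^'r" where
  "unvectorize v = (\<chi> i j. v $ (j, i))"

lemma vectorize_unvectorize [simp]: "vectorize (unvectorize v) = v"
  by (simp add: vectorize_def unvectorize_def vec_eq_iff)

lemma unvectorize_vectorize [simp]: "unvectorize (vectorize W) = W"
  by (simp add: vectorize_def unvectorize_def vec_eq_iff)


section \<open>Definiteness, pseudoinverse, Schur complement\<close>

definition sym_mat :: "real^'n^'n \<Rightarrow> bool" where
  "sym_mat A \<longleftrightarrow> transpose A = A"

definition pos_semidef :: "real^'n^'n \<Rightarrow> bool" where
  "pos_semidef A \<longleftrightarrow> sym_mat A \<and> (\<forall>v. v \<bullet> (A *v v) \<ge> 0)"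

definition pos_def :: "real^'n^'n \<Rightarrow> bool" where
  "pos_def A \<longleftrightarrow> sym_mat A \<and> (\<forall>v. v \<noteq> 0 \<longrightarrow> v \<bullet> (A *v v) > 0)"

definition neg_semidef :: "real^'n^'n \<Rightarrow> bool" where
  "neg_semidef A \<longleftrightarrow> pos_semidef (- A)"

definition is_pseudoinverse :: "real^'n^'m \<Rightarrow> real^'m^'n \<Rightarrow> bool" where
  "is_pseudoinverse A P \<longleftrightarrow>
     A ** P ** A = A \<and> P ** A ** P = P \<and> sym_mat (A ** P) \<and> sym_mat (P ** A)"

definition pseudoinverse :: "real^'n^'m \<Rightarrow> real^'m^'n" where
  "pseudoinverse A = (THE P. is_pseudoinverse A P)"

lemma pseudoinverse_unique:
  assumes P: "is_pseudoinverse A P" and R: "is_pseudoinverse A R"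
  shows "P = R"
proof -
  note p = P[unfolded is_pseudoinverse_def sym_mat_def]
  note r = R[unfolded is_pseudoinverse_def sym_mat_def]
  have "A ** P = (A ** R) ** (A ** P)"
    using r by (metis matrix_mul_assoc)
  also have "\<dots> = transpose ((A ** P) ** (A ** R))"
    using p r by (simp add: matrix_transpose_mul)
  also have "(A ** P) ** (A ** R) = A ** R"
    using p by (metis matrix_mul_assoc)
  finally have 1: "A ** P = A ** R" using r by simp
  have "P ** A = (P ** A) ** (R ** A)"
    using r by (metis matrix_mul_assoc)
  also have "\<dots> = transpose ((R ** A) ** (P ** A))"
    using p r by (simp add: matrix_transpose_mul)
  also have "(R ** A) ** (P ** A) = R ** A"
    using p by (metis matrix_mul_assoc)
  finally have 2: "P ** A = R ** A" using r by simp
  show ?thesis using 1 2 p r by (metis matrix_mul_assoc)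
qed

lemma pseudoinverse_eqI: "is_pseudoinverse A P \<Longrightarrow> pseudoinverse A = P"
  unfolding pseudoinverse_def by (blast intro: pseudoinverse_unique)

definition schur_compl :: "real^('p + 'q::finite)^('p + 'q) \<Rightarrow> real^'p^'p" where
  "schur_compl M = blk11 M - blk12 M ** pseudoinverse (blk22 M) ** blk21 M"

definition Pi_set :: "(real^('p::finite + 'q::finite)^('p + 'q)) set" where
  "Pi_set = {M. sym_mat M \<and> neg_semidef (blk22 M) \<and>
     {v. blk22 M *v v = 0} \<subseteq> {v. blk12 M *v v = 0} \<and> pos_semidef (schur_compl M)}"


section \<open>Data and noise model\<close>

text \<open>The horizon \<open>T\<close> is the cardinality of the linearly ordered finite type \<open>'t\<close>, whose
  elements are numbered \<open>0, \<dots>, T - 1\<close> in increasing order.  Input and state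
  sequences are functions on \<^typ>\<open>nat\<close>; only \<open>u(0), \<dots>, u(T - 1)\<close> and
  \<open>x(0), \<dots>, x(T)\<close> are ever used.\<close>

definition time_of :: "'t::{finite,linorder} \<Rightarrow> nat" where
  "time_of t = card {s. s < t}"

lemma bij_betw_time_of: "bij_betw (time_of :: 't::{finite,linorder} \<Rightarrow> nat) UNIV {..<CARD('t)}"
proof -
  have "strict_mono (time_of :: 't \<Rightarrow> nat)"
    unfolding time_of_def by (intro strict_monoI psubset_card_mono) auto
  then have inj: "inj (time_of :: 't \<Rightarrow> nat)" by (rule strict_mono_imp_inj_on)
  have "range (time_of :: 't \<Rightarrow> nat) \<subseteq> {..<CARD('t)}"
    unfolding time_of_def by (auto intro!: psubset_card_mono)
  with inj show ?thesis
    by (metis (no_types) bij_betw_def card_image card_lessThan card_subset_eq finite_lessThan)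
qed

definition data_minus :: "(nat \<Rightarrow> real^'k) \<Rightarrow> real^('t::{finite,linorder})^'k" where
  "data_minus x = (\<chi> i t. x (time_of t) $ i)"

definition data_plus :: "(nat \<Rightarrow> real^'k) \<Rightarrow> real^('t::{finite,linorder})^'k" where
  "data_plus x = (\<chi> i t. x (Suc (time_of t)) $ i)"

definition data_XU ::
  "(nat \<Rightarrow> real^'m) \<Rightarrow> (nat \<Rightarrow> real^'n) \<Rightarrow> real^('t::{finite,linorder})^('n + 'm)" where
  "data_XU u x = stack (data_minus x) (data_minus u)"

definition noise_set :: "real^(1 + 't \<times> 'n)^(1 + 't \<times> 'n) \<Rightarrow> (real^'t^'n) set" where
  "noise_set \<Phi> =
     {W. let w = stack (mat 1 :: real^1^1) (columnvector (vectorize W))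
         in (transpose w ** \<Phi> ** w) $ 1 $ 1 \<ge> 0}"

definition compatible_systems ::
  "(nat \<Rightarrow> real^'m) \<Rightarrow> (nat \<Rightarrow> real^'n) \<Rightarrow> (real^('t::{finite,linorder})^'n) set
     \<Rightarrow> ((real^'n^'n) \<times> (real^'m^'n)) set" where
  "compatible_systems u x \<W> =
     {(A, B). \<exists>W\<in>\<W>. data_plus x = A ** data_minus x + B ** data_minus u + W}"


section \<open>Informativity\<close>

definition informative ::
  "(nat \<Rightarrow> real^'m) \<Rightarrow> (nat \<Rightarrow> real^'n) \<Rightarrow> (real^('t::{finite,linorder})^'n) set
     \<Rightarrow> 'th set \<Rightarrow> ('th \<Rightarrow> real^('n + ('n + 'm))^('n + ('n + 'm))) \<Rightarrow> bool" where
  "informative u x \<W> \<Theta> M \<longleftrightarrow>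
     (\<exists>\<theta>\<in>\<Theta>. \<forall>(A, B)\<in>compatible_systems u x \<W>.
        let S = stack (mat 1 :: real^'n^'n) (stack (transpose A) (transpose B))
        in pos_def (transpose S ** M \<theta> ** S))"

definition C_YL :: "real^'n^'p \<Rightarrow> real^'m^'p \<Rightarrow> real^'n^'n \<Rightarrow> real^'n^'m \<Rightarrow> real^'n^'p" where
  "C_YL C D Y L = C ** Y + D ** L"

definition Theta_Hinf ::
  "real^'n^'p \<Rightarrow> real^'m^'p \<Rightarrow> ((real^'n^'n) \<times> (real^'n^'m)) set" where
  "Theta_Hinf C D =
     {(Y, L). sym_mat Y \<and> pos_def (Y - transpose (C_YL C D Y L) ** C_YL C D Y L)}"

definition M_Hinf ::
  "real \<Rightarrow> real^'n^'p \<Rightarrow> real^'m^'p \<Rightarrow> (real^'n^'n) \<times> (real^'n^'m)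
     \<Rightarrow> real^('n + ('n + 'm))^('n + ('n + 'm))" where
  "M_Hinf \<gamma> C D = (\<lambda>(Y, L).
     block_mat
       (Y - (1 / \<gamma>\<^sup>2) *\<^sub>R mat 1) 0
       0 (- (stack Y L ** matrix_inv (Y - transpose (C_YL C D Y L) ** C_YL C D Y L)
              ** transpose (stack Y L))))"

text \<open>The standing hypothesis \<open>M\<^sub>2\<^sub>2 \<le> 0\<close> on \<open>\<Theta>\<close>, left out of \<^const>\<open>informative\<close>,
  holds for \<^const>\<open>M_Hinf\<close>:\<close>

lemma pos_def_matrix_inv:
  fixes A :: "real^'n^'n"
  assumes "pos_def A" shows "pos_semidef (matrix_inv A)"
proof -
  have s: "transpose A = A" and p: "\<And>v. v \<noteq> 0 \<Longrightarrow> v \<bullet> (A *v v) > 0"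
    using assms by (auto simp: pos_def_def sym_mat_def)
  have "inj ((*v) A)"
    by (rule linear_injective_0[THEN iffD2]) (use p in \<open>force+\<close>)
  then have "invertible A"
    by (simp add: invertible_left_inverse matrix_left_invertible_injective)
  then have inv: "A ** matrix_inv A = mat 1" "matrix_inv A ** A = mat 1"
    unfolding invertible_def matrix_inv_def by (metis (mono_tags, lifting) someI_ex)+
  have st: "transpose (matrix_inv A) = matrix_inv A"
    by (metis inv s matrix_transpose_mul transpose_mat matrix_mul_assoc matrix_mul_lid matrix_mul_rid)
  have "v \<bullet> (matrix_inv A *v v) \<ge> 0" for v
  proof -
    define w where "w = matrix_inv A *v v"
    have v: "v = A *v w" by (simp add: w_def matrix_vector_mul_assoc inv)
    have "v \<bullet> w = w \<bullet> (A *v w)" using v by (simp add: inner_commute)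
    then show ?thesis using p[of w] by (cases "w = 0") (auto simp: w_def)
  qed
  with st show ?thesis by (simp add: pos_semidef_def sym_mat_def)
qed

lemma pos_semidef_congruence:
  fixes S :: "real^'n^'k"
  assumes "pos_semidef P" shows "pos_semidef (S ** P ** transpose S)"
proof -
  have "v \<bullet> ((S ** P ** transpose S) *v v) = (transpose S *v v) \<bullet> (P *v (transpose S *v v))" for v
    by (simp add: dot_lmul_matrix transpose_matrix_vector flip: matrix_vector_mul_assoc)
  with assms show ?thesis
    by (auto simp: pos_semidef_def sym_mat_def matrix_transpose_mul matrix_mul_assoc)
qed

lemma M_Hinf_neg_semidef:
  assumes "\<theta> \<in> Theta_Hinf C D"
  shows "neg_semidef (blk22 (M_Hinf \<gamma> C D \<theta>))"
proof -
  obtain Y L where \<theta>: "\<theta> = (Y, L)" by (cases \<theta>)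
  let ?S = "Y - transpose (C_YL C D Y L) ** C_YL C D Y L"
  have "- blk22 (M_Hinf \<gamma> C D \<theta>) = stack Y L ** matrix_inv ?S ** transpose (stack Y L)"
    by (simp add: \<theta> M_Hinf_def blk22_def block_mat_def vec_eq_iff)
  moreover have "pos_semidef (matrix_inv ?S)"
    using assms by (intro pos_def_matrix_inv) (simp add: \<theta> Theta_Hinf_def)
  ultimately show ?thesis
    by (simp add: neg_semidef_def pos_semidef_congruence)
qed


section \<open>The data-dependent matrices and the linear matrix inequality\<close>

definition E_mat ::
  "(nat \<Rightarrow> real^'m) \<Rightarrow> (nat \<Rightarrow> real^'n)
     \<Rightarrow> real^(1 + ('n + 'm) \<times> 'n)^(1 + ('t::{finite,linorder}) \<times> 'n)" where
  "E_mat u x =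
     block_mat
       (mat 1) 0
       (columnvector (vectorize (data_plus x))) (- kronecker (transpose (data_XU u x)) (mat 1))"

definition N_mat ::
  "(nat \<Rightarrow> real^'m) \<Rightarrow> (nat \<Rightarrow> real^'n)
     \<Rightarrow> real^(1 + 't \<times> 'n)^(1 + ('t::{finite,linorder}) \<times> 'n)
     \<Rightarrow> real^(1 + ('n + 'm) \<times> 'n)^(1 + ('n + 'm) \<times> 'n)" where
  "N_mat u x \<Phi> = transpose (E_mat u x) ** \<Phi> ** E_mat u x"

definition Q22_mat ::
  "(nat \<Rightarrow> real^'m) \<Rightarrow> (nat \<Rightarrow> real^'n) \<Rightarrow> real^('t::{finite,linorder})^('t::{finite,linorder})
     \<Rightarrow> real^('n + 'm)^('n + 'm)" where
  "Q22_mat u x \<phi> = data_XU u x ** \<phi> ** transpose (data_XU u x)"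

definition Q12_mat ::
  "(nat \<Rightarrow> real^'m) \<Rightarrow> (nat \<Rightarrow> real^'n)
     \<Rightarrow> real^(1 + 't \<times> 'n)^(1 + ('t::{finite,linorder}) \<times> 'n)
     \<Rightarrow> real^('n + 'm)^'n" where
  "Q12_mat u x \<Phi> = unvectorize (column 1 (blk21 (N_mat u x \<Phi>)))"

definition Q_mat ::
  "(nat \<Rightarrow> real^'m) \<Rightarrow> (nat \<Rightarrow> real^'n) \<Rightarrow> real^('t::{finite,linorder})^('t::{finite,linorder})
     \<Rightarrow> real^(1 + 't \<times> 'n)^(1 + ('t::{finite,linorder}) \<times> 'n)
     \<Rightarrow> real^('n + ('n + 'm))^('n + ('n + 'm))" where
  "Q_mat u x \<phi> \<Phi> =
     (let Q12 = Q12_mat u x \<Phi>; Q21 = transpose Q12; Q22 = Q22_mat u x \<phi>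
      in block_mat
           ((schur_compl (N_mat u x \<Phi>) $ 1 $ 1) *\<^sub>R mat 1 + Q12 ** pseudoinverse Q22 ** Q21) Q12
           Q21 Q22)"

text \<open>The left-hand side of the inequality with diagonal blocks of sizes \<open>n, n, m, n, p\<close>, grouped
  as \<open>(n + (n + m)) + (n + p)\<close>; the second and third block rows (and columns) are
  treated together as one of size \<open>n + m\<close>.\<close>

definition LMI_mat ::
  "real \<Rightarrow> real^'n^'p \<Rightarrow> real^'m^'p \<Rightarrow> real^('n + ('n + 'm))^('n + ('n + 'm))
     \<Rightarrow> real^'n^'n \<Rightarrow> real^'n^'m \<Rightarrow> real \<Rightarrow> real
     \<Rightarrow> real^(('n + ('n + 'm)) + ('n + 'p))^(('n + ('n + 'm)) + ('n + 'p))" where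
  "LMI_mat \<gamma> C D Q Y L \<alpha> \<beta> =
     block_mat
       (block_mat
          (Y - (1 / \<gamma>\<^sup>2) *\<^sub>R mat 1 - \<beta> *\<^sub>R mat 1) 0
          0                                          0)
       (block_mat
          0           0
          (stack Y L) 0)
       (block_mat
          0 (beside Y (transpose L))
          0 0)
       (block_mat
          Y              (transpose (C_YL C D Y L))
          (C_YL C D Y L) (mat 1))
     - \<alpha> *\<^sub>R block_mat Q 0 0 0"


section \<open>Stability and the H-infinity norm\<close>

definition complex_mat :: "real^'c^'r \<Rightarrow> complex^'c^'r" where
  "complex_mat A = (\<chi> i j. complex_of_real (A $ i $ j))"

definition stable_mat :: "real^'n^'n \<Rightarrow> bool" where
  "stable_mat A \<longleftrightarrow>
     (\<forall>z::complex. (\<exists>v. v \<noteq> 0 \<and> complex_mat A *v v = z *s v) \<longrightarrow> cmod z < 1)"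

definition closed_loop_transfer ::
  "real^'n^'p \<Rightarrow> real^'m^'p \<Rightarrow> real^'n^'n \<Rightarrow> real^'m^'n \<Rightarrow> real^'n^'m \<Rightarrow> complex \<Rightarrow> complex^'n^'p" where
  "closed_loop_transfer C D A B K z =
     complex_mat (C + D ** K) ** matrix_inv (mat z - complex_mat (A + B ** K))"

text \<open>\<^const>\<open>onorm\<close> is the operator norm for the Euclidean norms, i.e. the largest singular value.
  The supremum is extended-real so that an unbounded transfer matrix has norm \<open>\<infinity>\<close>.\<close>

definition Hinf_norm :: "(complex \<Rightarrow> complex^'n^'p) \<Rightarrow> ereal" where
  "Hinf_norm G = (SUP z\<in>{z. cmod z > 1}. ereal (onorm ((*v) (G z))))"

end

theory Submission
  imports Defs
begin

text \<open>Write \<open>Z = [A B]\<close>.  Completing the square turns data compatibility into the Frobenius-norm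
  ellipsoid \<open>tr ((Z - Z\<^sub>0) R (Z - Z\<^sub>0)\<^sup>T) \<le> s\<close> with \<open>R = - Q\<^sub>2\<^sub>2\<close>, while \<open>Q\<close> describes the larger
  spectral-norm ellipsoid.  For a fixed \<open>v \<noteq> 0\<close> both sets have the same image under
  \<open>Z \<mapsto> Z\<^sup>T v\<close>, namely \<open>{y. [v; y]\<^sup>T Q [v; y] \<ge> 0}\<close>, so informativity is an implication between two
  quadratic forms in \<open>(v, y)\<close>.  A compactness argument gives it a margin, the S-lemma a
  multiplier \<open>\<alpha>\<close>, and two Schur complements the linear matrix inequality.  For the closed loop, the
  same form inequality is a dissipation inequality with storage function \<open>a\<^sup>T Y\<^sup>-\<^sup>1 a\<close>.\<close>

section \<open>Block vectors and matrices\<close>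

text \<open>Positivity is required for each system and each v separately, and (A, B) enters only
  through Z^T v. The quantifiers over systems and vectors therefore merge into one over pairs (v,
  y), and the gap between the Frobenius and the spectral ellipsoid costs nothing. Two degeneracies
  of the data shape the rest. R may be singular, and then the set of compatible systems is
  unbounded; the kernel of R has to be projected out before compactness can be used. The radius s
  may be zero, and then no point satisfies the constraint strictly; enlarging the constraint by the
  margin restores one. The same margin becomes the \<beta> of the inequality. In the closed loop
  \<beta> raises the weight 1/\<gamma>^2 to 1/\<gamma>^2 + \<beta>, which keeps the norm bound
  strict after the supremum over |z| > 1.\<close>

definition vjoin :: "'a^'c \<Rightarrow> 'a^'d \<Rightarrow> 'a^('c + 'd)" where
  "vjoin a b = (\<chi> i. case i of Inl r \<Rightarrow> a $ r | Inr s \<Rightarrow> b $ s)"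

lemma vjoin_nth [simp]: "vjoin a b $ Inl i = a $ i" "vjoin a b $ Inr j = b $ j"
  by (simp_all add: vjoin_def)

lemma vec_eq_iff_sum:
  "(x :: 'a^('c::finite + 'd::finite)) = y \<longleftrightarrow> (\<forall>i. x $ Inl i = y $ Inl i) \<and> (\<forall>j. x $ Inr j = y $ Inr j)"
  unfolding vec_eq_iff by (metis sum.exhaust)

lemma vjoin_cases:
  fixes x :: "'a^('c::finite + 'd::finite)"
  obtains a b where "x = vjoin a b"
proof
  show "x = vjoin (\<chi> i. x $ Inl i) (\<chi> j. x $ Inr j)"
    by (simp add: vec_eq_iff_sum)
qed

lemma vjoin_eq_iff [simp]: "vjoin a b = vjoin c d \<longleftrightarrow> a = c \<and> b = d"
  by (auto simp: vec_eq_iff_sum vec_eq_iff)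

lemma vjoin_0_0 [simp]: "vjoin 0 0 = 0"
  by (simp add: vec_eq_iff_sum)

lemma vjoin_eq_0_iff: "vjoin a b = 0 \<longleftrightarrow> a = 0 \<and> b = 0"
  by (metis vjoin_0_0 vjoin_eq_iff)

lemma sum_UNIV_sum_type:
  "(\<Sum>i\<in>(UNIV :: ('c::finite + 'd::finite) set). f i) = (\<Sum>i\<in>UNIV. f (Inl i)) + (\<Sum>j\<in>UNIV. f (Inr j))"
  unfolding UNIV_Plus_UNIV[symmetric] by (subst sum.Plus) (auto simp: comp_def)

lemma inner_vjoin [simp]: "vjoin a b \<bullet> vjoin c d = a \<bullet> c + b \<bullet> (d :: real^'d)"
  by (simp add: inner_vec_def sum_UNIV_sum_type)

lemma vjoin_add: "vjoin a b + vjoin c d = vjoin (a + c) (b + d)"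
  by (simp add: vec_eq_iff_sum)

lemma block_mat_nth [simp]:
  "block_mat A B C D $ Inl i $ Inl j = A $ i $ j"
  "block_mat A B C D $ Inl i $ Inr j' = B $ i $ j'"
  "block_mat A B C D $ Inr i' $ Inl j = C $ i' $ j"
  "block_mat A B C D $ Inr i' $ Inr j' = D $ i' $ j'"
  by (simp_all add: block_mat_def)

lemma stack_nth [simp]: "stack A B $ Inl i = A $ i" "stack A B $ Inr j = B $ j"
  by (simp_all add: stack_def)

lemma beside_nth [simp]: "beside A B $ i $ Inl c = A $ i $ c" "beside A B $ i $ Inr d = B $ i $ d"
  by (simp_all add: beside_def)

lemma block_mat_blocks: "block_mat (blk11 M) (blk12 M) (blk21 M) (blk22 M) = M"
  by (simp add: vec_eq_iff_sum blk11_def blk12_def blk21_def blk22_def)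

lemma blocks_block_mat [simp]:
  "blk11 (block_mat A B C D) = A" "blk12 (block_mat A B C D) = B"
  "blk21 (block_mat A B C D) = C" "blk22 (block_mat A B C D) = D"
  by (simp_all add: vec_eq_iff blk11_def blk12_def blk21_def blk22_def)

lemma block_mat_mult_vjoin:
  fixes A :: "real^'c^'r" and D :: "real^'d^'s"
  shows "block_mat A B C D *v vjoin a b = vjoin (A *v a + B *v b) (C *v a + D *v b)"
  by (simp add: vec_eq_iff_sum matrix_vector_mult_def sum_UNIV_sum_type)

lemma matrix_mult_vjoin:
  fixes M :: "real^('c::finite + 'd::finite)^('r::finite + 's::finite)"
  shows "M *v vjoin a b = vjoin (blk11 M *v a + blk12 M *v b) (blk21 M *v a + blk22 M *v b)"
  by (metis block_mat_blocks block_mat_mult_vjoin)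

lemma transpose_block_mat:
  "transpose (block_mat A B C D) = block_mat (transpose A) (transpose C) (transpose B) (transpose D)"
  by (simp add: vec_eq_iff_sum transpose_def)

lemma block_mat_eq_iff:
  "block_mat A B C D = block_mat A' B' C' D' \<longleftrightarrow> A = A' \<and> B = B' \<and> C = C' \<and> D = D'"
  by (metis blocks_block_mat)

lemma stack_mult_vec: "stack A B *v (v :: real^'n) = vjoin (A *v v) (B *v v)"
  by (simp add: vec_eq_iff_sum matrix_vector_mult_def)

lemma transpose_stack: "transpose (stack A B) = beside (transpose A) (transpose B)"
  by (simp add: transpose_def stack_def beside_def vec_eq_iff split: sum.split)

lemma transpose_beside: "transpose (beside A B) = stack (transpose A) (transpose B)"
  by (simp add: transpose_def stack_def beside_def vec_eq_iff split: sum.split)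

lemma beside_mult_stack:
  fixes A :: "real^'c^'r" and B :: "real^'d^'r"
  shows "beside A B ** stack C D = A ** C + B ** D"
  by (simp add: vec_eq_iff matrix_matrix_mult_def sum_UNIV_sum_type)

lemma beside_cases:
  fixes Z :: "'a^('c::finite + 'd::finite)^'r"
  obtains A B where "Z = beside A B"
proof
  show "Z = beside (\<chi> i j. Z $ i $ Inl j) (\<chi> i j. Z $ i $ Inr j)"
    by (simp add: beside_def vec_eq_iff split: sum.split)
qed

section \<open>Adjoints, congruences and matrix arithmetic\<close>

lemma inner_matrix_transpose: "(A *v x) \<bullet> y = x \<bullet> (transpose A *v (y :: real^'m))"
  by (metis dot_lmul_matrix inner_commute transpose_matrix_vector)

lemma inner_transpose_matrix: "x \<bullet> (A *v (y :: real^'m)) = (transpose A *v x) \<bullet> y"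
  by (metis inner_matrix_transpose transpose_transpose)

lemma sym_mat_block_mat:
  "sym_mat (block_mat A B C D) \<longleftrightarrow> sym_mat A \<and> C = transpose B \<and> sym_mat D"
  by (auto simp: sym_mat_def transpose_block_mat block_mat_eq_iff)

lemma matrix_add_rdistrib: "(A + B) ** C = A ** C + B ** (C :: real^'c^'b)"
  by (simp add: matrix_matrix_mult_def vec_eq_iff distrib_right sum.distrib)

lemma matrix_diff_ldistrib: "A ** (B - C) = A ** B - A ** (C :: real^'c^'b)"
  by (simp add: matrix_matrix_mult_def vec_eq_iff right_diff_distrib sum_subtractf)

lemma matrix_diff_rdistrib: "(A - B) ** C = A ** C - B ** (C :: real^'c^'b)"
  by (simp add: matrix_matrix_mult_def vec_eq_iff left_diff_distrib sum_subtractf)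

lemma transpose_diff: "transpose (A - B) = transpose A - transpose (B :: real^'n^'m)"
  by (simp add: transpose_def vec_eq_iff)

lemma transpose_0 [simp]: "transpose 0 = (0 :: real^'n^'m)"
  by (simp add: transpose_def vec_eq_iff)

lemma transpose_add: "transpose (A + B) = transpose A + transpose (B :: real^'n^'m)"
  by (simp add: transpose_def vec_eq_iff)

lemma transpose_minus: "transpose (- A) = - transpose (A :: real^'n^'m)"
  by (simp add: transpose_def vec_eq_iff)

lemma transpose_scaleR: "transpose (c *\<^sub>R A) = c *\<^sub>R transpose (A :: real^'n^'m)"
  by (simp add: transpose_def vec_eq_iff)

lemma matrix_minus_mult_vec: "(- M) *v v = - (M *v (v :: real^'n))"
  by (simp add: vec_eq_iff matrix_vector_mult_def sum_negf)

lemma matrix_mult_minus_left: "(- M) ** N = - (M ** (N :: real^'n^'m))"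
  by (simp add: vec_eq_iff matrix_matrix_mult_def sum_negf)

lemma matrix_mult_minus_right: "M ** (- N) = - (M ** (N :: real^'n^'m))"
  by (simp add: vec_eq_iff matrix_matrix_mult_def sum_negf)

lemma inner_congruence:
  "x \<bullet> ((transpose E ** M ** E) *v y) = ((E :: real^'n^'m) *v x) \<bullet> (M *v (E *v y))"
  by (simp only: matrix_vector_mul_assoc[symmetric] inner_transpose_matrix[of x "transpose E"]
      transpose_transpose)

lemma sym_mat_congruence: "sym_mat M \<Longrightarrow> sym_mat (transpose E ** M ** E)"
  by (simp add: sym_mat_def matrix_transpose_mul matrix_mul_assoc)

section \<open>Rank-one matrices, vectorization and Kronecker products\<close>

text \<open>The rank-one matrix v y^T. It serves as a test matrix, turning statements about
  \<open>vectorize\<close>d matrices into statements about vectors, and later as the perturbation of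
  the centre of the ellipsoid.\<close>

definition outer :: "real^'r \<Rightarrow> real^'c \<Rightarrow> real^'c^'r" where
  "outer v y = (\<chi> i j. v $ i * y $ j)"

lemma outer_mult: "outer v y ** M = outer v (transpose M *v y)"
  by (simp add: outer_def vec_eq_iff matrix_matrix_mult_def matrix_vector_mult_def transpose_def
      sum_distrib_left mult_ac)

lemma inner_outer: "M \<bullet> outer v y = v \<bullet> (M *v y)"
  by (simp add: outer_def inner_vec_def matrix_vector_mult_def sum_distrib_left mult_ac)

lemma outer_mult_vec: "outer v y *v w = (y \<bullet> w) *\<^sub>R v"
  by (simp add: outer_def inner_vec_def matrix_vector_mult_def vec_eq_iff sum_distrib_left
      mult_ac)

lemma transpose_outer: "transpose (outer v y) = outer y v"
  by (simp add: outer_def transpose_def vec_eq_iff)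

lemma inner_matrix_mult_right: "(X :: real^'c^'r) \<bullet> (Y ** M) = (X ** transpose M) \<bullet> Y"
proof -
  have "(\<Sum>j\<in>UNIV. \<Sum>k\<in>UNIV. X $ i $ j * (Y $ i $ k * M $ k $ j)) =
      (\<Sum>j\<in>UNIV. \<Sum>k\<in>UNIV. X $ i $ k * M $ j $ k * Y $ i $ j)" for i
    by (subst sum.swap) (simp add: mult_ac)
  then show ?thesis
    by (simp add: inner_vec_def matrix_matrix_mult_def transpose_def sum_distrib_left
        sum_distrib_right mult_ac)
qed

lemma inner_vectorize: "vectorize X \<bullet> vectorize Y = X \<bullet> Y"
proof -
  have "vectorize X \<bullet> vectorize Y = (\<Sum>(j, i)\<in>UNIV \<times> UNIV. X $ i $ j * Y $ i $ j)"
    by (simp add: inner_vec_def vectorize_def case_prod_beta)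
  also have "\<dots> = X \<bullet> Y"
    unfolding sum.cartesian_product[symmetric] inner_vec_def
    by (subst sum.swap) (simp add: inner_vec_def)
  finally show ?thesis .
qed

lemma vectorize_diff: "vectorize (X - Y) = vectorize X - vectorize Y"
  by (simp add: vec_eq_iff vectorize_def)

lemma vectorize_0 [simp]: "vectorize 0 = 0"
  by (simp add: vec_eq_iff vectorize_def)

lemma sum_UNIV_prod:
  "(\<Sum>k\<in>(UNIV :: ('a::finite \<times> 'b::finite) set). f k) = (\<Sum>a\<in>UNIV. \<Sum>b\<in>UNIV. f (a, b))"
  unfolding UNIV_Times_UNIV[symmetric] sum.cartesian_product by (simp add: case_prod_beta)

lemma kronecker_mult_vectorize:
  "kronecker A (mat 1) *v vectorize X = vectorize (X ** transpose A)"
proof -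
  have *: "(\<Sum>b\<in>UNIV. A $ i $ a * (if j = b then 1 else 0) * X $ b $ a) = X $ j $ a * A $ i $ a"
    for i j a
    by (simp add: if_distrib if_distribR sum.delta mult.commute cong: if_cong)
  show ?thesis
    by (simp add: vec_eq_iff kronecker_def vectorize_def matrix_vector_mult_def sum_UNIV_prod
        matrix_matrix_mult_def transpose_def mat_def *)
qed

lemma kronecker_mult:
  "kronecker A B ** kronecker C D = kronecker (A ** C) (B ** D)"
  by (simp add: vec_eq_iff kronecker_def matrix_matrix_mult_def sum_UNIV_prod sum_product mult_ac)

lemma transpose_kronecker: "transpose (kronecker A B) = kronecker (transpose A) (transpose B)"
  by (simp add: vec_eq_iff kronecker_def transpose_def)

section \<open>Positive semidefinite matrices and pseudoinverses\<close>

lemma sym_mat_inner: "sym_mat A \<Longrightarrow> x \<bullet> (A *v y) = y \<bullet> (A *v x)"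
  by (metis inner_commute inner_transpose_matrix sym_mat_def)

text \<open>Expand the form at \<open>c *\<^sub>R x - A *v x\<close>, where \<open>c\<close> bounds
  the operator \<open>A\<close>. This gives both that zeros of the form lie in the kernel and that a
  bound on the form bounds the image, without matrix square roots.\<close>

lemma pos_semidef_image_bound:
  fixes A :: "real^'n^'n"
  assumes "pos_semidef A"
  obtains c where "c > 0" "\<And>x. (norm (A *v x))\<^sup>2 \<le> c * (x \<bullet> (A *v x))"
proof -
  obtain c where c: "c > 0" "\<And>x. norm (A *v x) \<le> norm x * c"
    using bounded_linear.pos_bounded[OF matrix_vector_mul_bounded_linear[of A]] by blast
  have "(norm (A *v x))\<^sup>2 \<le> c * (x \<bullet> (A *v x))" for x
  proof -
    let ?y = "A *v x"
    have "?y \<bullet> (A *v ?y) \<le> norm ?y * (norm ?y * c)"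
      by (meson c(2) mult_left_mono norm_cauchy_schwarz norm_ge_zero order_trans)
    then have 1: "?y \<bullet> (A *v ?y) \<le> c * (norm ?y)\<^sup>2"
      by (simp add: power2_eq_square mult_ac)
    have "0 \<le> (c *\<^sub>R x - ?y) \<bullet> (A *v (c *\<^sub>R x - ?y))"
      using assms by (simp add: pos_semidef_def)
    also have "\<dots> = c\<^sup>2 * (x \<bullet> ?y) - c * (x \<bullet> (A *v ?y)) - c * (?y \<bullet> ?y) + ?y \<bullet> (A *v ?y)"
      by (simp add: matrix_vector_mult_diff_distrib matrix_vector_mult_scaleR inner_diff_left
          inner_diff_right power2_eq_square algebra_simps)
    also have "x \<bullet> (A *v ?y) = ?y \<bullet> ?y"
      using assms by (metis pos_semidef_def sym_mat_inner)
    finally have "0 \<le> c\<^sup>2 * (x \<bullet> ?y) - 2 * c * (norm ?y)\<^sup>2 + c * (norm ?y)\<^sup>2"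
      using 1 by (simp add: power2_norm_eq_inner)
    then have "c * (norm ?y)\<^sup>2 \<le> c * (c * (x \<bullet> ?y))"
      by (simp add: power2_eq_square algebra_simps)
    then show ?thesis using c(1) by simp
  qed
  with c(1) show ?thesis by (rule that)
qed

lemma pos_semidef_inner_eq_0:
  assumes "pos_semidef A" "x \<bullet> (A *v x) = 0"
  shows "A *v x = 0"
  using pos_semidef_image_bound[OF assms(1)] assms(2)
  by (metis mult_zero_right norm_eq_zero power2_less_eq_zero_iff)

lemma pos_def_matrix_inv_mult:
  fixes A :: "real^'n^'n"
  assumes "pos_def A"
  shows "A ** matrix_inv A = mat 1" "matrix_inv A ** A = mat 1"
proof -
  have "inj ((*v) A)"
    using assms by (intro linear_injective_0[THEN iffD2]) (force simp: pos_def_def)+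
  then have "invertible A"
    by (simp add: invertible_left_inverse matrix_left_invertible_injective)
  then show "A ** matrix_inv A = mat 1" "matrix_inv A ** A = mat 1"
    unfolding invertible_def matrix_inv_def by (metis (mono_tags, lifting) someI_ex)+
qed

lemma pos_def_imp_pos_semidef: "pos_def P \<Longrightarrow> pos_semidef P"
  unfolding pos_def_def pos_semidef_def by (metis inner_zero_left order_le_less)

text \<open>The Schur complement as a minimization: over w, the first two terms have minimum - z^T
  P^-1 z, attained at w = - P^-1 z.\<close>

lemma complete_square:
  fixes P :: "real^'n^'n"
  assumes "pos_def P"
  shows "w \<bullet> (P *v w) + 2 * (w \<bullet> z) + z \<bullet> (matrix_inv P *v z) =
    (w + matrix_inv P *v z) \<bullet> (P *v (w + matrix_inv P *v z))"
proof -
  let ?a = "matrix_inv P *v z"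
  have "P *v ?a = z"
    by (simp add: matrix_vector_mul_assoc pos_def_matrix_inv_mult[OF assms])
  moreover have "?a \<bullet> (P *v w) = w \<bullet> (P *v ?a)"
    using assms by (intro sym_mat_inner) (simp add: pos_def_def)
  ultimately show ?thesis
    by (simp add: matrix_vector_right_distrib inner_add_left inner_add_right inner_commute)
qed

section \<open>Orthogonal projections and existence of the pseudoinverse\<close>

lemma orthogonal_projection_matrix:
  fixes S :: "(real^'n) set"
  assumes "subspace S"
  obtains P :: "real^'n^'n" where "sym_mat P" "\<And>x. P *v x \<in> S" "\<And>x. x \<in> S \<Longrightarrow> P *v x = x"
proof -
  obtain B where B: "B \<subseteq> S" "pairwise orthogonal B" "\<And>x. x \<in> B \<Longrightarrow> norm x = 1" "independent B"
      "span B = S"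
    using orthonormal_basis_subspace[OF assms] by metis
  have fin: "finite B" using B(4) independent_imp_finite by blast
  define P where "P = (\<Sum>b\<in>B. outer b b)"
  have P: "P *v x = (\<Sum>b\<in>B. (b \<bullet> x) *\<^sub>R b)" for x
    unfolding P_def using fin
    by (induction B rule: finite_induct) (simp_all add: matrix_vector_mult_add_rdistrib outer_mult_vec)
  show thesis
  proof
    have "transpose P = P"
      unfolding P_def using fin
      by (induction B rule: finite_induct)
        (simp_all add: transpose_def outer_def vec_eq_iff mult.commute)
    then show "sym_mat P" by (simp add: sym_mat_def)
    show "P *v x \<in> S" for x
      unfolding P using B(1) by (intro subspace_sum subspace_scale assms) auto
    have "P *v b = b" if "b \<in> B" for b
    proof -
      have "(\<Sum>c\<in>B. (c \<bullet> b) *\<^sub>R c) = (b \<bullet> b) *\<^sub>R b + (\<Sum>c\<in>B-{b}. (c \<bullet> b) *\<^sub>R c)"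
        using that fin by (simp add: sum.remove)
      also have "(\<Sum>c\<in>B-{b}. (c \<bullet> b) *\<^sub>R c) = 0"
        using B(2) that by (intro sum.neutral) (auto simp: pairwise_def orthogonal_def)
      finally show ?thesis using B(3)[OF that] by (simp add: P dot_square_norm)
    qed
    then show "P *v x = x" if "x \<in> S" for x
      using linear_eq_on_span[OF matrix_vector_mul_linear linear_id, of B P x] that B(5)
      by (auto simp: id_def)
  qed
qed

text \<open>With \<open>K\<close> the orthogonal projection onto the kernel of \<open>A\<close>, the matrix \<open>A + K\<close> is
  invertible and the pseudoinverse is \<open>(A + K)\<^sup>-\<^sup>1 - K\<close>.\<close>

lemma is_pseudoinverse_exists_sym:
  fixes A :: "real^'n^'n"
  assumes "sym_mat A"
  shows "\<exists>P. is_pseudoinverse A P"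
proof -
  have sub: "subspace {x. A *v x = 0}"
    by (simp add: subspace_def matrix_vector_right_distrib matrix_vector_mult_scaleR)
  obtain K :: "real^'n^'n" where K: "sym_mat K" "\<And>x. A *v (K *v x) = 0" "\<And>x. A *v x = 0 \<Longrightarrow> K *v x = x"
    by (rule orthogonal_projection_matrix[OF sub]) auto
  have AK: "A ** K = 0"
    by (rule matrix_eq[THEN iffD2]) (simp add: K matrix_vector_mul_assoc[symmetric])
  have KA: "K ** A = 0"
  proof -
    have "K ** A = transpose (A ** K)"
      using K(1) assms by (simp add: matrix_transpose_mul sym_mat_def)
    then show ?thesis by (simp add: AK transpose_def vec_eq_iff)
  qed
  have KK: "K ** K = K"
    by (rule matrix_eq[THEN iffD2]) (simp add: K matrix_vector_mul_assoc[symmetric])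
  define B where "B = A + K"
  \<comment> \<open>The ranges of \<open>A\<close> and \<open>K\<close> meet only in 0: if A x = - K
    x, then A x lies in the kernel of \<open>A\<close>, and symmetry gives |A x|^2 = x^T A (A x) =
    0.\<close>
  have "x = 0" if "B *v x = 0" for x
  proof -
    have "A *v x = - (K *v x)"
      using that by (simp add: B_def matrix_vector_mult_add_rdistrib eq_neg_iff_add_eq_0)
    then have "A *v (A *v x) = 0"
      using K(2)[of "- x"] by (simp add: matrix_vector_mult_def sum_negf vec_eq_iff)
    then have "(A *v x) \<bullet> (A *v x) = 0"
      using assms by (metis inner_matrix_transpose inner_zero_right sym_mat_def)
    then have "A *v x = 0" by simp
    with that K(3)[OF this] show ?thesis
      by (simp add: B_def matrix_vector_mult_add_rdistrib)
  qed
  then have "invertible B"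
    by (simp add: invertible_left_inverse matrix_left_invertible_ker)
  then obtain V where V: "B ** V = mat 1" "V ** B = mat 1"
    by (auto simp: invertible_def)
  have BK: "B ** K = K" "K ** B = K"
    by (simp_all add: B_def matrix_add_ldistrib matrix_add_rdistrib AK KA KK)
  have VK: "V ** K = K" "K ** V = K"
    by (metis BK V matrix_mul_assoc matrix_mul_lid matrix_mul_rid)+
  have A: "A = B - K" by (simp add: B_def)
  have AP: "A ** (V - K) = mat 1 - K" "(V - K) ** A = mat 1 - K"
    unfolding A by (simp_all add: matrix_diff_ldistrib matrix_diff_rdistrib V BK VK KK)
  have "is_pseudoinverse A (V - K)"
    unfolding is_pseudoinverse_def AP
    using K(1) by (simp add: matrix_diff_ldistrib matrix_diff_rdistrib KA VK KK sym_mat_def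
        transpose_diff)
  then show ?thesis by blast
qed

text \<open>\<open>pseudoinverse\<close> is a definite description, so this existence statement is
  what gives it meaning. Symmetric matrices suffice here, since both \<open>Q22_mat\<close> and the
  lower right block of \<open>N_mat\<close> are symmetric.\<close>

lemma is_pseudoinverse_pseudoinverse:
  "sym_mat A \<Longrightarrow> is_pseudoinverse A (pseudoinverse A)"
  using is_pseudoinverse_exists_sym pseudoinverse_eqI by metis

text \<open>The Penrose equations of a symmetric matrix are invariant under transposition, so
  uniqueness applies.\<close>

lemma sym_mat_pseudoinverse:
  assumes "sym_mat A"
  shows "sym_mat (pseudoinverse A)"
proof -
  have "is_pseudoinverse A (transpose (pseudoinverse A))"
    using is_pseudoinverse_pseudoinverse[OF assms] assms
      arg_cong[of _ _ transpose, of "A ** pseudoinverse A ** A"]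
      arg_cong[of _ _ transpose, of "pseudoinverse A ** A ** pseudoinverse A"]
    by (auto simp: is_pseudoinverse_def sym_mat_def matrix_transpose_mul matrix_mul_assoc)
  then show ?thesis
    unfolding sym_mat_def by (rule pseudoinverse_eqI[symmetric])
qed

lemma pseudoinverse_kronecker:
  assumes "sym_mat A"
  shows "pseudoinverse (kronecker A (mat 1)) = kronecker (pseudoinverse A) (mat 1)"
  using is_pseudoinverse_pseudoinverse[OF assms]
  by (intro pseudoinverse_eqI)
    (simp add: is_pseudoinverse_def kronecker_mult sym_mat_def transpose_kronecker)

section \<open>The S-lemma\<close>

text \<open>The last conclusion is Vieta's formula. The S-lemma needs the product of the roots as
  well as their signs, because it becomes the ratio of the two values of g.\<close>

lemma quadratic_roots_of_opposite_sign:
  fixes a b c :: real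
  assumes "a > 0" "c < 0"
  obtains t1 t2 where "t1 < 0" "0 < t2" "a + t1 * b + t1\<^sup>2 * c = 0" "a + t2 * b + t2\<^sup>2 * c = 0"
    "t1 * t2 = a / c"
proof -
  define d where "d = sqrt (b\<^sup>2 - 4 * a * c)"
  have ac: "a * c < 0" using assms by (simp add: mult_pos_neg)
  then have d2: "d\<^sup>2 = b\<^sup>2 - 4 * a * c" using zero_le_power2[of b] unfolding d_def by (intro real_sqrt_pow2) linarith
  have "\<bar>b\<bar> < d"
    unfolding d_def using ac by (intro real_less_rsqrt) simp
  then have bd: "- b + d > 0" "- b - d < 0" by linarith+
  show thesis
  proof (rule that[of "(- b + d) / (2 * c)" "(- b - d) / (2 * c)"])
    show "(- b + d) / (2 * c) < 0" "0 < (- b - d) / (2 * c)"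
      using bd assms by (simp_all add: divide_pos_neg divide_neg_neg)
    have "a + (- b + e) / (2 * c) * b + ((- b + e) / (2 * c))\<^sup>2 * c = 0"
      if "e\<^sup>2 = b\<^sup>2 - 4 * a * c" for e
    proof -
      have "a + (- b + e) / (2 * c) * b + ((- b + e) / (2 * c))\<^sup>2 * c
          = (e\<^sup>2 - (b\<^sup>2 - 4 * a * c)) / (4 * c)"
        using assms by (simp add: field_simps power2_eq_square)
      with that show ?thesis by simp
    qed
    from this[of d] this[of "- d"]
    show "a + (- b + d) / (2 * c) * b + ((- b + d) / (2 * c))\<^sup>2 * c = 0"
      "a + (- b - d) / (2 * c) * b + ((- b - d) / (2 * c))\<^sup>2 * c = 0"
      using d2 by simp_all
    have "(- b + d) / (2 * c) * ((- b - d) / (2 * c)) = (b\<^sup>2 - d\<^sup>2) / (4 * c\<^sup>2)"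
      by (simp add: power2_eq_square algebra_simps)
    also have "\<dots> = a / c"
      using assms by (simp add: d2) (simp add: power2_eq_square)
    finally show "(- b + d) / (2 * c) * ((- b - d) / (2 * c)) = a / c" .
  qed
qed

text \<open>The multiplier is the infimum of \<open>f / g\<close> over \<open>g > 0\<close>.  It dominates \<open>f / g\<close> on \<open>g < 0\<close>:
  for \<open>g x > 0 > g y\<close>, add up the inequalities \<open>f \<ge> 0\<close> at the two zeros of \<open>g\<close> on the
  line \<open>x + t y\<close> with the weights that cancel the term linear in \<open>t\<close>.\<close>

lemma S_lemma:
  fixes f g :: "'a::real_vector \<Rightarrow> real"
  assumes f: "\<And>x y t. f (x + t *\<^sub>R y) = f x + t * bf x y + t\<^sup>2 * f y"
    and g: "\<And>x y t. g (x + t *\<^sub>R y) = g x + t * bg x y + t\<^sup>2 * g y"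
    and fg: "\<And>x. g x \<ge> 0 \<Longrightarrow> f x \<ge> 0"
    and slater: "g x0 > 0"
  obtains \<alpha> where "\<alpha> \<ge> 0" "\<And>x. f x \<ge> \<alpha> * g x"
proof -
  have key: "f y / g y \<le> f x / g x" if x: "g x > 0" and y: "g y < 0" for x y
  proof -
    obtain t1 t2 where t: "t1 < 0" "0 < t2" "g x + t1 * bg x y + t1\<^sup>2 * g y = 0"
      "g x + t2 * bg x y + t2\<^sup>2 * g y = 0" and t12: "t1 * t2 = g x / g y"
      using quadratic_roots_of_opposite_sign[OF x y] by metis
    have 1: "0 \<le> f x + t1 * bf x y + t1\<^sup>2 * f y" "0 \<le> f x + t2 * bf x y + t2\<^sup>2 * f y"
      using fg[of "x + t1 *\<^sub>R y"] fg[of "x + t2 *\<^sub>R y"] t unfolding f g by simp_all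
    have "0 \<le> t2 * (f x + t1 * bf x y + t1\<^sup>2 * f y) - t1 * (f x + t2 * bf x y + t2\<^sup>2 * f y)"
      using mult_nonneg_nonneg[OF less_imp_le[OF t(2)] 1(1)]
        mult_nonpos_nonneg[OF less_imp_le[OF t(1)] 1(2)] by linarith
    also have "\<dots> = (t2 - t1) * (f x - t1 * t2 * f y)"
      by (simp add: algebra_simps power2_eq_square)
    finally have "0 \<le> f x - g x / g y * f y"
      using t(1,2) unfolding t12 by (simp add: zero_le_mult_iff)
    then show ?thesis
      using x y by (simp add: field_simps)
  qed
  define S where "S = (\<lambda>x. f x / g x) ` {x. g x > 0}"
  have ne: "S \<noteq> {}" using slater by (auto simp: S_def)
  have nonneg: "0 \<le> s" if "s \<in> S" for s
    using that fg by (auto simp: S_def)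
  then have bdd: "bdd_below S" by (meson bdd_below.I)
  show thesis
  proof
    show "Inf S \<ge> 0" using ne nonneg by (rule cInf_greatest)
    show "f x \<ge> Inf S * g x" for x
    proof (cases "g x" "0 :: real" rule: linorder_cases)
      case less
      then have "f x / g x \<le> Inf S"
        using key ne by (intro cInf_greatest) (auto simp: S_def)
      then show ?thesis using less by (simp add: field_simps)
    next
      case equal
      then show ?thesis using fg by simp
    next
      case greater
      then have "Inf S \<le> f x / g x"
        using bdd by (intro cInf_lower) (auto simp: S_def)
      then show ?thesis using greater by (simp add: field_simps)
    qed
  qed
qed

text \<open>Directions in the kernel of \<open>R\<close> are unconstrained, so that \<open>K\<close> vanishes on them; modulo that
  kernel the constraint set is compact.\<close>

lemma strict_inequality_margin:
  fixes H :: "real^'n^'n" and K R :: "real^'k^'k" and G :: "real^'n^'k"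
  assumes K: "pos_semidef K" and R: "pos_semidef R" and s: "s \<ge> 0"
    and pos: "\<And>v e. v \<noteq> 0 \<Longrightarrow> e \<bullet> (R *v e) \<le> s * (v \<bullet> v) \<Longrightarrow>
      v \<bullet> (H *v v) - (G *v v + e) \<bullet> (K *v (G *v v + e)) > 0"
  obtains \<epsilon> where "\<epsilon> > 0" "\<And>v e. e \<bullet> (R *v e) \<le> (s + \<epsilon>) * (v \<bullet> v) \<Longrightarrow>
      v \<bullet> (H *v v) - (G *v v + e) \<bullet> (K *v (G *v v + e)) \<ge> \<epsilon> * (v \<bullet> v)"
proof -
  have symK: "sym_mat K" and symR: "sym_mat R" using K R by (auto simp: pos_semidef_def)
  \<comment> \<open>Along the kernel of \<open>R\<close> the constraint allows arbitrarily large
    multiples of e; if \<open>K\<close> did not vanish there, the form would eventually become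
    negative.\<close>
  have Kker: "K *v e = 0" if e: "R *v e = 0" for e
  proof (rule ccontr)
    assume "K *v e \<noteq> 0"
    then have q: "e \<bullet> (K *v e) > 0"
      using K pos_semidef_inner_eq_0 by (metis order_le_less pos_semidef_def)
    obtain v :: "real^'n" where v: "v \<noteq> 0" using one_neq_zero by blast
    let ?w = "G *v v"
    define a where "a = v \<bullet> (H *v v)"
    \<comment> \<open>Chosen so that t \<ge> 1 and t (e^T K e) \<ge> |a| + 1; hence t^2 (e^T K e)
      already exceeds a. The sign of \<open>t'\<close> then keeps the cross term from
      compensating.\<close>
    define t where "t = (\<bar>a\<bar> + 1) / (e \<bullet> (K *v e)) + 1"
    have "t \<ge> 1" "t * (e \<bullet> (K *v e)) = \<bar>a\<bar> + 1 + e \<bullet> (K *v e)"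
      using q by (simp_all add: t_def field_simps)
    with q have t: "t \<ge> 1" "t * (e \<bullet> (K *v e)) \<ge> \<bar>a\<bar> + 1" by simp_all
    define t' where "t' = (if ?w \<bullet> (K *v e) \<ge> 0 then t else - t)"
    have "(?w + t' *\<^sub>R e) \<bullet> (K *v (?w + t' *\<^sub>R e)) =
        ?w \<bullet> (K *v ?w) + 2 * (t' * (?w \<bullet> (K *v e))) + t * (t * (e \<bullet> (K *v e)))"
      using sym_mat_inner[OF symK, of e ?w]
      by (auto simp: t'_def matrix_vector_right_distrib matrix_vector_mult_scaleR inner_add_left
          inner_add_right algebra_simps vec.neg)
    moreover have "?w \<bullet> (K *v ?w) \<ge> 0" using K by (simp add: pos_semidef_def)
    moreover have "t' * (?w \<bullet> (K *v e)) \<ge> 0"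
      using t(1) by (auto simp: t'_def mult_nonneg_nonpos)
    moreover have "t * (t * (e \<bullet> (K *v e))) \<ge> 1 * (\<bar>a\<bar> + 1)"
      using t by (intro mult_mono) auto
    moreover have "a - (?w + t' *\<^sub>R e) \<bullet> (K *v (?w + t' *\<^sub>R e)) > 0"
      unfolding a_def using e s by (intro pos v) (simp add: matrix_vector_mult_scaleR)
    ultimately show False by (smt (verit))
  qed
  \<comment> \<open>The projection along the kernel of \<open>R\<close>. Replacing e by P e changes
    neither quadratic form, and on the range of \<open>P\<close> the constraint bounds e.\<close>
  define P where "P = pseudoinverse R ** R"
  have RP: "R ** P = R" "P ** P = P"
    using is_pseudoinverse_pseudoinverse[OF symR]
    by (auto simp: P_def is_pseudoinverse_def matrix_mul_assoc)
  have RPv: "R *v (P *v e) = R *v e" for e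
    by (simp add: RP matrix_vector_mul_assoc)
  have KPv: "K *v (P *v e) = K *v e" for e
    using Kker[of "P *v e - e"] by (simp add: RPv matrix_vector_mult_diff_distrib)
  obtain c where c: "c > 0" "\<And>x. (norm (R *v x))\<^sup>2 \<le> c * (x \<bullet> (R *v x))"
    using pos_semidef_image_bound[OF R] by blast
  obtain b where b: "b > 0" "\<And>x. norm (pseudoinverse R *v x) \<le> norm x * b"
    using bounded_linear.pos_bounded[OF matrix_vector_mul_bounded_linear[of "pseudoinverse R"]] by blast
  define X where "X = {(v :: real^'n, e). norm v = 1 \<and> P *v e = e \<and> e \<bullet> (R *v e) \<le> s + 1}"
  define F where "F v e = v \<bullet> (H *v v) - (G *v v + e) \<bullet> (K *v (G *v v + e))" for v e
  \<comment> \<open>The maximum encodes an implication: it is positive if the form is positive or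
    the original constraint fails. Being continuous, it has a positive minimum on the compact set
    \<open>X\<close>, where the constraint is relaxed to s + 1.\<close>
  define h where "h = (\<lambda>(v, e). max (F v e) (e \<bullet> (R *v e) - s))"
  have cont: "continuous_on S (\<lambda>x. M *v f x)"
    if "continuous_on S f" for S :: "((real^'n) \<times> (real^'k)) set" and M :: "real^'i^'j" and f
    using that by (rule bounded_linear.continuous_on[OF matrix_vector_mul_bounded_linear])
  have bnd: "norm e \<le> sqrt (c * (s + 1)) * b" if "P *v e = e" "e \<bullet> (R *v e) \<le> s + 1" for e
  proof -
    have "norm e \<le> norm (R *v e) * b"
      using b(2)[of "R *v e"] that(1) by (simp add: P_def matrix_vector_mul_assoc)
    also have "(norm (R *v e))\<^sup>2 \<le> c * (s + 1)"
      using c(2)[of e] mult_left_mono[OF that(2), of c] c(1) by linarith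
    then have "norm (R *v e) * b \<le> sqrt (c * (s + 1)) * b"
      using b(1) by (intro mult_right_mono real_le_rsqrt) auto
    finally show ?thesis .
  qed
  have "compact X"
    unfolding compact_eq_bounded_closed
  proof (rule conjI)
    have "X \<subseteq> cball 0 1 \<times> cball 0 (sqrt (c * (s + 1)) * b)"
      using bnd by (auto simp: X_def)
    then show "bounded X"
      by (rule bounded_subset[rotated]) (intro bounded_Times bounded_cball)
    have "X = {x. norm (fst x) = 1} \<inter> {x. P *v snd x = snd x} \<inter> {x. snd x \<bullet> (R *v snd x) \<le> s + 1}"
      by (auto simp: X_def)
    also have "closed \<dots>"
      by (intro closed_Int closed_Collect_eq closed_Collect_le continuous_intros cont)
    finally show "closed X" .
  qed
  have "continuous_on X h"
    unfolding h_def case_prod_beta F_def by (intro continuous_intros cont)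
  have hpos: "h x > 0" if "x \<in> X" for x
  proof -
    obtain v e where x: "x = (v, e)" by (cases x)
    with that have v: "norm v = 1" by (simp add: X_def)
    then have "v \<noteq> 0" "v \<bullet> v = 1" by (auto simp: dot_square_norm)
    then show ?thesis
      using pos[of v e] by (auto simp: h_def x F_def less_max_iff_disj)
  qed
  obtain \<delta> where \<delta>: "\<delta> > 0" "\<And>x. x \<in> X \<Longrightarrow> \<delta> \<le> h x"
  proof (cases "X = {}")
    case True
    then show ?thesis using that[of 1] by auto
  next
    case False
    then obtain z where "z \<in> X" "\<forall>x\<in>X. h z \<le> h x"
      using continuous_attains_inf[OF \<open>compact X\<close> _ \<open>continuous_on X h\<close>] by blast
    then show ?thesis
      using that[of "h z"] hpos[of z] by simp
  qed
  \<comment> \<open>\<epsilon> \<le> 1 keeps the relaxed points inside \<open>X\<close>; \<epsilon>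
    < \<delta> rules out the second argument of the maximum, so that \<open>F\<close> itself must be
    at least \<delta>.\<close>
  define \<epsilon> where "\<epsilon> = min (\<delta> / 2) 1"
  have \<epsilon>: "0 < \<epsilon>" "\<epsilon> < \<delta>" "\<epsilon> \<le> 1" using \<delta>(1) by (auto simp: \<epsilon>_def min_less_iff_disj)
  have unit: "F v e \<ge> \<epsilon>" if v: "norm v = 1" and e: "e \<bullet> (R *v e) \<le> s + \<epsilon>" for v e
  proof -
    have eP: "(P *v e) \<bullet> (R *v e) = e \<bullet> (R *v e)"
      using sym_mat_inner[OF symR, of "P *v e" e] by (simp add: RPv)
    have Kv: "K *v (G *v v + P *v e) = K *v (G *v v + e)"
      by (simp add: matrix_vector_right_distrib KPv)
    have "(G *v v + P *v e) \<bullet> (K *v (G *v v + P *v e)) = (G *v v + e) \<bullet> (K *v (G *v v + P *v e))"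
      unfolding Kv using sym_mat_inner[OF symK, of "G *v v + P *v e" "G *v v + e"] unfolding Kv .
    then have FP: "F v (P *v e) = F v e" by (simp add: F_def Kv)
    have "(v, P *v e) \<in> X"
      using v e \<epsilon> eP by (auto simp: X_def RP matrix_vector_mul_assoc)
    from \<delta>(2)[OF this] show ?thesis
      using e \<epsilon> by (auto simp: h_def RPv eP FP le_max_iff_disj)
  qed
  show thesis
  proof (rule that[OF \<epsilon>(1)])
    fix v :: "real^'n" and e
    assume e: "e \<bullet> (R *v e) \<le> (s + \<epsilon>) * (v \<bullet> v)"
    show "v \<bullet> (H *v v) - (G *v v + e) \<bullet> (K *v (G *v v + e)) \<ge> \<epsilon> * (v \<bullet> v)"
    proof (cases "v = 0")
      \<comment> \<open>Homogeneity cannot reduce v = 0 to the unit sphere. Here the constraint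
        forces e into the kernel of \<open>R\<close>, hence into that of \<open>K\<close>.\<close>
      case True
      with e R have "e \<bullet> (R *v e) = 0" by (auto simp: pos_semidef_def intro: antisym)
      then have "K *v e = 0" using R pos_semidef_inner_eq_0 Kker by blast
      with True show ?thesis by simp
    next
      case False
      define r where "r = norm v"
      have r: "r > 0" "v \<bullet> v = r\<^sup>2" using False by (auto simp: r_def dot_square_norm)
      define v' e' where "v' = v /\<^sub>R r" and "e' = e /\<^sub>R r"
      have v: "v = r *\<^sub>R v'" and e': "e = r *\<^sub>R e'" using r by (auto simp: v'_def e'_def)
      have "F v' e' \<ge> \<epsilon>"
      proof (rule unit)
        show "norm v' = 1" using r by (simp add: v'_def r_def)
        have "e' \<bullet> (R *v e') * r\<^sup>2 \<le> (s + \<epsilon>) * r\<^sup>2"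
          using e unfolding r(2) by (simp add: e' matrix_vector_mult_scaleR power2_eq_square mult_ac)
        then show "e' \<bullet> (R *v e') \<le> s + \<epsilon>" using r(1) by simp
      qed
      moreover have "G *v v + e = r *\<^sub>R (G *v v' + e')"
        by (simp add: v e' matrix_vector_mult_scaleR scaleR_add_right)
      then have "F v e = r\<^sup>2 * F v' e'"
        unfolding F_def by (simp add: v matrix_vector_mult_scaleR power2_eq_square right_diff_distrib mult_ac)
      ultimately show ?thesis
        using r by (simp add: F_def mult.commute)
    qed
  qed
qed

section \<open>The set of data-compatible systems\<close>

lemma stack_1_columnvector: "stack (mat 1 :: real^1^1) (columnvector w) = columnvector (vjoin 1 w)"
  by (simp add: vec_eq_iff_sum columnvector_def vec_eq_iff mat_def)

lemma column_matrix_mult: "column j (A ** B) = A *v column j (B :: real^'n^'m)"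
  by (simp add: column_def matrix_matrix_mult_def matrix_vector_mult_def vec_eq_iff)

lemma congruence_nth:
  "(transpose X ** M ** X) $ i $ j = column i X \<bullet> (M *v column j (X :: real^'n^'m))"
proof -
  have "(A ** B) $ i $ j = row i A \<bullet> column j B" for A :: "real^'m^'n" and B :: "real^'n^'m"
    by (simp add: matrix_matrix_mult_def inner_vec_def row_def column_def)
  then show ?thesis
    by (simp only: matrix_mul_assoc[symmetric] column_matrix_mult row_transpose)
qed

lemma column_columnvector: "column j (columnvector w) = w"
  by (simp add: column_def columnvector_def vec_eq_iff)

lemma columnvector_mult: "columnvector v *v a = (a :: real^1) $ 1 *\<^sub>R (v :: real^'n)"
  by (simp add: vec_eq_iff columnvector_def matrix_vector_mult_def)

lemma noise_set_iff:
  "W \<in> noise_set \<Phi> \<longleftrightarrow> vjoin 1 (vectorize W) \<bullet> (\<Phi> *v vjoin 1 (vectorize W)) \<ge> 0"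
  by (simp add: noise_set_def Let_def stack_1_columnvector congruence_nth column_columnvector)

lemma E_mat_mult:
  "E_mat u x *v vjoin a (vectorize Z) = vjoin a (a $ 1 *\<^sub>R vectorize (data_plus x) - vectorize (Z ** data_XU u x))"
  by (simp add: E_mat_def block_mat_mult_vjoin columnvector_mult matrix_minus_mult_vec
      kronecker_mult_vectorize)

lemma N_mat_form:
  "x' \<bullet> (N_mat u x \<Phi> *v y') = (E_mat u x *v x') \<bullet> (\<Phi> *v (E_mat u x *v y'))"
  unfolding N_mat_def by (rule inner_congruence)

text \<open>The noise matrix is the residual of the data equation and thus determined by (A, B);
  \<open>E_mat\<close> is the substitution taking (1, vec [A B]) to (1, vec W).\<close>

lemma compatible_iff:
  "(A, B) \<in> compatible_systems u x (noise_set \<Phi>) \<longleftrightarrow>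
    vjoin 1 (vectorize (beside A B)) \<bullet> (N_mat u x \<Phi> *v vjoin 1 (vectorize (beside A B))) \<ge> 0"
proof -
  have "(A, B) \<in> compatible_systems u x (noise_set \<Phi>) \<longleftrightarrow>
      data_plus x - beside A B ** data_XU u x \<in> noise_set \<Phi>"
    by (force simp: compatible_systems_def data_XU_def beside_mult_stack)
  then show ?thesis
    by (simp add: noise_set_iff N_mat_form E_mat_mult vectorize_diff)
qed

text \<open>At a rank-one matrix e y^T the Kronecker form factors as |e|^2 (y^T R y).\<close>

lemma pos_semidef_kronecker_D:
  assumes "pos_semidef (kronecker R (mat 1 :: real^'n^'n))"
  shows "pos_semidef R"
proof -
  have eq: "outer e y \<bullet> (outer e y ** transpose R) = (e \<bullet> e) * (y \<bullet> (R *v y))" for e :: "real^'n" and y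
    by (simp add: outer_mult inner_outer outer_mult_vec inner_commute)
  have "0 \<le> y \<bullet> (R *v y)" for y
  proof -
    obtain e :: "real^'n" where "e \<noteq> 0" using one_neq_zero by blast
    moreover have "0 \<le> vectorize (outer e y) \<bullet> (kronecker R (mat 1) *v vectorize (outer e y))"
      using assms by (simp add: pos_semidef_def)
    ultimately show ?thesis
      unfolding kronecker_mult_vectorize inner_vectorize eq
      by (metis inner_gt_zero_iff mult_pos_neg not_less)
  qed
  moreover have "kronecker (transpose R) (mat 1 :: real^'n^'n) = kronecker R (mat 1)"
    using assms by (simp add: pos_semidef_def sym_mat_def transpose_kronecker)
  then have "kronecker (transpose R) (mat 1 :: real^'n^'n) $ (i, k) $ (j, k) =
      kronecker R (mat 1 :: real^'n^'n) $ (i, k) $ (j, k)" for i j k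
    by simp
  then have "transpose R $ i $ j = R $ i $ j" for i j
    by (simp add: kronecker_def mat_def)
  ultimately show ?thesis
    by (simp add: pos_semidef_def sym_mat_def vec_eq_iff)
qed

lemma neg_kronecker: "- kronecker A B = kronecker (- A) B"
  by (simp add: kronecker_def vec_eq_iff)

text \<open>Compared as bilinear forms on \<open>vectorize\<close>d matrices, which avoids
  multiplying out the blocks of \<open>E_mat\<close>.\<close>

lemma blk22_N_mat:
  fixes u :: "nat \<Rightarrow> real^'m" and x :: "nat \<Rightarrow> real^'n"
    and \<Phi> :: "real^(1 + 't \<times> 'n)^(1 + ('t::{finite,linorder}) \<times> 'n)"
  assumes "blk22 \<Phi> = kronecker \<phi> (mat 1 :: real^'n^'n)"
  shows "blk22 (N_mat u x \<Phi>) = kronecker (Q22_mat u x \<phi>) (mat 1)"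
proof -
  have "blk22 (N_mat u x \<Phi>) *v vectorize Z = kronecker (Q22_mat u x \<phi>) (mat 1) *v vectorize Z" for Z
  proof (rule vector_eq_ldot[THEN iffD1], rule allI)
    fix z :: "real^(('n + 'm) \<times> 'n)"
    obtain Z' where z: "z = vectorize Z'" by (metis vectorize_unvectorize)
    have "z \<bullet> (blk22 (N_mat u x \<Phi>) *v vectorize Z) = vjoin 0 z \<bullet> (N_mat u x \<Phi> *v vjoin 0 (vectorize Z))"
      by (simp add: matrix_mult_vjoin)
    also have "\<dots> = vectorize (Z' ** data_XU u x) \<bullet> (blk22 \<Phi> *v vectorize (Z ** data_XU u x))"
      unfolding N_mat_form z E_mat_mult by (simp add: matrix_mult_vjoin vec.neg)
    also have "\<dots> = z \<bullet> (kronecker (Q22_mat u x \<phi>) (mat 1) *v vectorize Z)"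
      unfolding assms z Q22_mat_def
      by (simp add: kronecker_mult_vectorize inner_vectorize inner_matrix_mult_right
          matrix_transpose_mul matrix_mul_assoc)
    finally show "z \<bullet> (blk22 (N_mat u x \<Phi>) *v vectorize Z) =
      z \<bullet> (kronecker (Q22_mat u x \<phi>) (mat 1) *v vectorize Z)" .
  qed
  from this[of "unvectorize _"] show ?thesis
    unfolding matrix_eq by simp
qed

text \<open>Both forms are completed to squares with the same centre - Q12 Q22^\<dagger> and the
  same radius, the scalar Schur complement of \<open>N_mat\<close>. With a singular Q22 this
  requires Q12 to vanish on its kernel, which is inherited from the kernel condition on
  \<Phi>.\<close>

lemma data_ellipsoid:
  fixes u :: "nat \<Rightarrow> real^'m" and x :: "nat \<Rightarrow> real^'n"
    and \<Phi> :: "real^(1 + 't \<times> 'n)^(1 + ('t::{finite,linorder}) \<times> 'n)"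
  assumes \<Phi>: "\<Phi> \<in> Pi_set" and \<phi>: "sym_mat \<phi>"
    and \<Phi>22: "blk22 \<Phi> = kronecker \<phi> (mat 1 :: real^'n^'n)"
  obtains Z\<^sub>0 :: "real^('n + 'm)^'n" and R s where "pos_semidef R"
    "\<And>A B. (A, B) \<in> compatible_systems u x (noise_set \<Phi>) \<longleftrightarrow>
       (beside A B - Z\<^sub>0) \<bullet> ((beside A B - Z\<^sub>0) ** R) \<le> s"
    "\<And>v y. vjoin v y \<bullet> (Q_mat u x \<phi> \<Phi> *v vjoin v y) =
       s * (v \<bullet> v) - (y - transpose Z\<^sub>0 *v v) \<bullet> (R *v (y - transpose Z\<^sub>0 *v v))"
proof -
  define N where "N = N_mat u x \<Phi>"
  define Q12 where "Q12 = Q12_mat u x \<Phi>"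
  define Q22 where "Q22 = Q22_mat u x \<phi>"
  define P where "P = pseudoinverse Q22"
  define Z\<^sub>0 where "Z\<^sub>0 = - (Q12 ** P)"
  define s where "s = schur_compl N $ 1 $ 1"
  have sym\<Phi>: "sym_mat \<Phi>" and neg\<Phi>: "pos_semidef (- blk22 \<Phi>)"
    and ker\<Phi>: "\<And>v. blk22 \<Phi> *v v = 0 \<Longrightarrow> blk12 \<Phi> *v v = 0"
    using \<Phi> by (auto simp: Pi_set_def neg_semidef_def)
  have symN: "sym_mat N"
    unfolding N_def N_mat_def by (rule sym_mat_congruence[OF sym\<Phi>])
  have N22: "blk22 N = kronecker Q22 (mat 1)"
    unfolding N_def Q22_def by (rule blk22_N_mat[OF \<Phi>22])
  have N21: "column 1 (blk21 N) = vectorize Q12"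
    by (simp add: N_def Q12_def Q12_mat_def)
  have "pos_semidef (- \<phi>)"
    using neg\<Phi> unfolding \<Phi>22 neg_kronecker by (rule pos_semidef_kronecker_D)
  then have "pos_semidef (data_XU u x ** (- \<phi>) ** transpose (data_XU u x))"
    by (rule pos_semidef_congruence)
  then have R: "pos_semidef (- Q22)"
    by (simp add: Q22_def Q22_mat_def matrix_mult_minus_left matrix_mult_minus_right)
  have symQ: "sym_mat Q22"
    using \<phi> by (simp add: Q22_def Q22_mat_def sym_mat_def matrix_transpose_mul matrix_mul_assoc)
  have symP: "sym_mat P" unfolding P_def by (rule sym_mat_pseudoinverse[OF symQ])
  have QPQ: "Q22 ** P ** Q22 = Q22" "P ** Q22 ** P = P"
    using is_pseudoinverse_pseudoinverse[OF symQ] by (auto simp: P_def is_pseudoinverse_def)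
  \<comment> \<open>For y in the kernel of \<open>Q22\<close>, the image of each e y^T under
    \<open>E_mat\<close> is a zero of the semidefinite form of the block of \<Phi>, hence in its
    kernel, hence annihilated by \<Phi>. The cross term of \<open>N\<close> at e y^T, which is e^T
    Q12 y, must therefore vanish.\<close>
  have kerQ: "Q12 *v y = 0" if y: "Q22 *v y = 0" for y
  proof -
    have "e \<bullet> (Q12 *v y) = 0" for e
    proof -
      let ?z = "vectorize (outer e y)" and ?w = "vectorize (outer e y ** data_XU u x)"
      have E: "E_mat u x *v vjoin 0 ?z = vjoin 0 (- ?w)"
        by (simp add: E_mat_mult)
      have "blk22 N *v ?z = 0"
        using symQ y unfolding N22 kronecker_mult_vectorize
        by (simp add: outer_mult sym_mat_def) (simp add: outer_def vectorize_def vec_eq_iff)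
      then have "0 = vjoin 0 ?z \<bullet> (N *v vjoin 0 ?z)"
        by (simp add: matrix_mult_vjoin)
      also have "\<dots> = (- ?w) \<bullet> (blk22 \<Phi> *v (- ?w))"
        unfolding N_def N_mat_form E by (simp add: matrix_mult_vjoin)
      finally have "(- blk22 \<Phi>) *v (- ?w) = 0"
        using pos_semidef_inner_eq_0[OF neg\<Phi>, of "- ?w"] by (simp add: matrix_minus_mult_vec)
      then have 1: "blk22 \<Phi> *v (- ?w) = 0" by (simp add: matrix_minus_mult_vec)
      from this have "blk12 \<Phi> *v (- ?w) = 0" by (rule ker\<Phi>)
      with 1 have "\<Phi> *v vjoin 0 (- ?w) = 0"
        by (simp add: matrix_mult_vjoin)
      then have "0 = vjoin (1 :: real^1) 0 \<bullet> (N *v vjoin 0 ?z)"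
        unfolding N_def N_mat_form E by simp
      also have "\<dots> = vjoin 0 ?z \<bullet> (N *v vjoin 1 0)"
        by (rule sym_mat_inner[OF symN])
      also have "\<dots> = ?z \<bullet> column 1 (blk21 N)"
        unfolding matrix_mult_vjoin inner_vjoin
        by (simp add: inner_vec_def matrix_vector_mult_def column_def)
      also have "\<dots> = e \<bullet> (Q12 *v y)"
        by (simp add: N21 inner_vectorize inner_commute inner_outer)
      finally show ?thesis by simp
    qed
    from this[of "Q12 *v y"] show ?thesis by simp
  qed
  have Z0Q: "Z\<^sub>0 ** Q22 = - Q12"
  proof -
    \<comment> \<open>I - P Q22 maps into the kernel of \<open>Q22\<close>, so Q12 P Q22 = Q12
      although \<open>Q22\<close> need not be invertible.\<close>
    have "Q12 *v ((mat 1 - P ** Q22) *v y) = 0" for y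
    proof (rule kerQ)
      have "Q22 ** (mat 1 - P ** Q22) = 0"
        by (simp add: matrix_diff_ldistrib matrix_mul_assoc QPQ)
      then show "Q22 *v ((mat 1 - P ** Q22) *v y) = 0"
        by (simp add: matrix_vector_mul_assoc)
    qed
    then have "Q12 ** (mat 1 - P ** Q22) = 0"
      by (simp add: matrix_eq matrix_vector_mul_assoc)
    then show ?thesis
      by (simp add: Z\<^sub>0_def matrix_diff_ldistrib matrix_mul_assoc matrix_mult_minus_left)
  qed
  have s: "s = N $ Inl 1 $ Inl 1 + Q12 \<bullet> Z\<^sub>0"
  proof -
    have "(blk12 N ** M ** blk21 N) $ 1 $ 1 = column 1 (blk21 N) \<bullet> (M *v column 1 (blk21 N))" for M
    proof -
      have "blk12 N = transpose (blk21 N)"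
        using symN by (simp add: sym_mat_def transpose_def blk12_def blk21_def vec_eq_iff)
      then show ?thesis by (simp only: congruence_nth)
    qed
    moreover have "pseudoinverse (blk22 N) = kronecker P (mat 1)"
      unfolding N22 P_def by (rule pseudoinverse_kronecker[OF symQ])
    ultimately show ?thesis
      using symP by (simp add: s_def schur_compl_def N21 kronecker_mult_vectorize inner_vectorize
          Z\<^sub>0_def sym_mat_def blk11_def)
  qed
  have "vjoin 1 (vectorize Z) \<bullet> (N *v vjoin 1 (vectorize Z)) = s - (Z - Z\<^sub>0) \<bullet> ((Z - Z\<^sub>0) ** (- Q22))" for Z
  proof -
    have e1: "vjoin 1 z \<bullet> (N *v vjoin 1 z) =
        N $ Inl 1 $ Inl 1 + 2 * (column 1 (blk21 N) \<bullet> z) + z \<bullet> (blk22 N *v z)" for z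
    proof -
      have "(1 :: real^1) \<bullet> (blk12 N *v z) = z \<bullet> (blk21 N *v 1)"
        using sym_mat_inner[OF symN, of "vjoin 1 0" "vjoin 0 z"] by (simp add: matrix_mult_vjoin)
      moreover have "z \<bullet> (blk21 N *v 1) = column 1 (blk21 N) \<bullet> z"
        by (simp add: inner_vec_def matrix_vector_mult_def column_def mult.commute)
      moreover have "(1 :: real^1) \<bullet> (blk11 N *v 1) = N $ Inl 1 $ Inl 1"
        by (simp add: inner_vec_def matrix_vector_mult_def blk11_def)
      ultimately show ?thesis
        by (simp add: matrix_mult_vjoin inner_add_right)
    qed
    have sw: "Z\<^sub>0 \<bullet> (Z ** Q22) = (Z\<^sub>0 ** Q22) \<bullet> Z"
      using symQ by (simp add: inner_matrix_mult_right sym_mat_def)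
    have "(Z - Z\<^sub>0) \<bullet> ((Z - Z\<^sub>0) ** (- Q22)) =
        - (Z \<bullet> (Z ** Q22)) + Z \<bullet> (Z\<^sub>0 ** Q22) + Z\<^sub>0 \<bullet> (Z ** Q22) - Z\<^sub>0 \<bullet> (Z\<^sub>0 ** Q22)"
      by (simp add: matrix_mult_minus_right matrix_diff_rdistrib inner_diff_left inner_diff_right)
    also have "\<dots> = - (Z \<bullet> (Z ** Q22)) - 2 * (Q12 \<bullet> Z) + Q12 \<bullet> Z\<^sub>0"
      unfolding sw Z0Q by (simp add: inner_commute)
    finally show ?thesis
      using symQ unfolding e1 N21 N22 kronecker_mult_vectorize inner_vectorize s
      by (simp add: sym_mat_def)
  qed
  then have 1: "(A, B) \<in> compatible_systems u x (noise_set \<Phi>) \<longleftrightarrow>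
       (beside A B - Z\<^sub>0) \<bullet> ((beside A B - Z\<^sub>0) ** (- Q22)) \<le> s" for A B
    unfolding compatible_iff N_def by simp
  have 2: "vjoin v y \<bullet> (Q_mat u x \<phi> \<Phi> *v vjoin v y) =
       s * (v \<bullet> v) - (y - transpose Z\<^sub>0 *v v) \<bullet> ((- Q22) *v (y - transpose Z\<^sub>0 *v v))" for v y
  proof -
    let ?w = "transpose Z\<^sub>0 *v v"
    \<comment> \<open>This is why the upper left block of Q contains Q12 Q22^\<dagger> Q21: it
      supplies the constant term of the square centred at
      \<open>transpose Z\<^sub>0 *v v\<close>.\<close>
    have "Q12 ** P ** transpose Q12 = Z\<^sub>0 ** Q22 ** transpose Z\<^sub>0"
    proof -
      have "transpose Z\<^sub>0 = - (P ** transpose Q12)"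
        using symP by (simp add: Z\<^sub>0_def sym_mat_def transpose_minus matrix_transpose_mul)
      then show ?thesis
        by (simp add: Z0Q matrix_mult_minus_left matrix_mult_minus_right matrix_mul_assoc)
    qed
    then have "v \<bullet> ((Q12 ** P ** transpose Q12) *v v) = ?w \<bullet> (Q22 *v ?w)"
      by (simp only: matrix_vector_mul_assoc[symmetric] inner_transpose_matrix[of v Z\<^sub>0])
    moreover have "v \<bullet> (Q12 *v y) = - (?w \<bullet> (Q22 *v y))"
    proof -
      have "?w \<bullet> (Q22 *v y) = v \<bullet> ((Z\<^sub>0 ** Q22) *v y)"
        unfolding matrix_vector_mul_assoc[symmetric] by (rule inner_transpose_matrix[symmetric])
      then show ?thesis unfolding Z0Q by (simp add: matrix_minus_mult_vec)
    qed
    moreover have "y \<bullet> (transpose Q12 *v v) = v \<bullet> (Q12 *v y)"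
      using inner_transpose_matrix[of v Q12 y] inner_commute[of y "transpose Q12 *v v"] by (rule trans[OF _ sym, rotated])
    moreover have "(y - ?w) \<bullet> ((- Q22) *v (y - ?w)) =
        - (y \<bullet> (Q22 *v y)) + 2 * (?w \<bullet> (Q22 *v y)) - ?w \<bullet> (Q22 *v ?w)"
      using sym_mat_inner[OF symQ, of y ?w] unfolding matrix_minus_mult_vec matrix_vector_mult_diff_distrib
        inner_minus_right inner_diff_left inner_diff_right by linarith
    moreover have "vjoin v y \<bullet> (Q_mat u x \<phi> \<Phi> *v vjoin v y) =
        s * (v \<bullet> v) + v \<bullet> ((Q12 ** P ** transpose Q12) *v v) + v \<bullet> (Q12 *v y)
        + y \<bullet> (transpose Q12 *v v) + y \<bullet> (Q22 *v y)"
      unfolding Q_mat_def Let_def N_def[symmetric] Q12_def[symmetric] Q22_def[symmetric]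
        P_def[symmetric] s_def[symmetric] block_mat_mult_vjoin inner_vjoin
        matrix_vector_mult_add_rdistrib inner_add_right scaleR_matrix_vector_assoc[symmetric]
      by simp
    ultimately show ?thesis by linarith
  qed
  show thesis
    by (rule that[OF R 1 2])
qed

text \<open>Only \<open>Z\<^sup>T v\<close> enters the quadratic inequality at \<open>v\<close>, and rank-one perturbations of the
  centre already reach every such value allowed by the spectral-norm bound.\<close>

lemma compatible_images:
  fixes Z\<^sub>0 :: "real^'k^'n"
  assumes R: "pos_semidef R" and v: "v \<noteq> 0"
  shows "(\<exists>Z. (Z - Z\<^sub>0) \<bullet> ((Z - Z\<^sub>0) ** R) \<le> s \<and> transpose Z *v v = y) \<longleftrightarrow>
    (y - transpose Z\<^sub>0 *v v) \<bullet> (R *v (y - transpose Z\<^sub>0 *v v)) \<le> s * (v \<bullet> v)"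
proof -
  define e where "e = y - transpose Z\<^sub>0 *v v"
  define q where "q = e \<bullet> (R *v e)"
  \<comment> \<open>The rank-one perturbation v e^T / |v|^2 sends v to e under its transpose, at
    cost q / |v|^2.\<close>
  define O1 where "O1 = outer ((1 / (v \<bullet> v)) *\<^sub>R v) e"
  have vv: "v \<bullet> v > 0" using v by simp
  have symR: "transpose R = R" using R by (simp add: pos_semidef_def sym_mat_def)
  have O2: "O1 \<bullet> (O1 ** R) = q / (v \<bullet> v)"
    using vv by (simp add: O1_def outer_mult inner_outer outer_mult_vec symR q_def inner_commute)
  have O3: "transpose O1 *v v = e"
    using vv by (simp add: O1_def transpose_outer outer_mult_vec del: transpose_matrix_vector)
  have nonneg: "0 \<le> \<Delta> \<bullet> (\<Delta> ** R)" for \<Delta> :: "real^'k^'n"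
  proof -
    have "\<Delta> \<bullet> (\<Delta> ** R) = (\<Sum>i\<in>UNIV. \<Delta> $ i \<bullet> (R *v \<Delta> $ i))"
    proof -
      have "(\<Delta> ** R) $ i = R *v \<Delta> $ i" for i
        by (subst symR[symmetric])
          (simp add: matrix_matrix_mult_def vector_matrix_mult_def vec_eq_iff mult.commute)
      then show ?thesis by (simp add: inner_vec_def[of \<Delta>])
    qed
    also have "\<dots> \<ge> 0"
      using R by (intro sum_nonneg) (simp add: pos_semidef_def)
    finally show ?thesis .
  qed
  show ?thesis
    unfolding e_def[symmetric] q_def[symmetric]
  proof
    assume "\<exists>Z. (Z - Z\<^sub>0) \<bullet> ((Z - Z\<^sub>0) ** R) \<le> s \<and> transpose Z *v v = y"
    then obtain Z where Z: "(Z - Z\<^sub>0) \<bullet> ((Z - Z\<^sub>0) ** R) \<le> s" "transpose Z *v v = y" by blast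
    define \<Delta> where "\<Delta> = Z - Z\<^sub>0"
    have \<Delta>v: "transpose \<Delta> *v v = e"
      using Z(2) by (simp add: \<Delta>_def transpose_diff matrix_vector_mult_diff_rdistrib e_def del: transpose_matrix_vector)
    \<comment> \<open>\<open>O1\<close> is the cheapest such perturbation: its inner product with
      any admissible \<Delta> equals its own cost, so the cost of \<Delta> exceeds that of
      \<open>O1\<close> by the cost of \<Delta> - \<open>O1\<close>.\<close>
    have "\<Delta> \<bullet> (O1 ** R) = q / (v \<bullet> v)"
    proof -
      have "\<Delta> \<bullet> (O1 ** R) = (1 / (v \<bullet> v)) * (v \<bullet> (\<Delta> *v (R *v e)))"
        by (simp add: O1_def outer_mult inner_outer symR)
      also have "v \<bullet> (\<Delta> *v (R *v e)) = q"
        by (simp only: inner_transpose_matrix[of v \<Delta>] \<Delta>v q_def)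
      finally show ?thesis by simp
    qed
    moreover have "O1 \<bullet> (\<Delta> ** R) = \<Delta> \<bullet> (O1 ** R)"
      by (simp add: inner_matrix_mult_right[of \<Delta>] symR inner_commute)
    ultimately have "0 \<le> \<Delta> \<bullet> (\<Delta> ** R) - q / (v \<bullet> v)"
      using nonneg[of "\<Delta> - O1"] O2
      by (simp add: matrix_diff_rdistrib inner_diff_left inner_diff_right)
    with Z(1) have "q / (v \<bullet> v) \<le> s" by (simp add: \<Delta>_def)
    then show "q \<le> s * (v \<bullet> v)" using vv by (simp add: pos_divide_le_eq)
  next
    assume "q \<le> s * (v \<bullet> v)"
    then have "O1 \<bullet> (O1 ** R) \<le> s" using vv by (simp add: O2 pos_divide_le_eq)
    moreover have "transpose (Z\<^sub>0 + O1) *v v = transpose Z\<^sub>0 *v v + transpose O1 *v v"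
      by (simp add: transpose_add matrix_vector_mult_add_rdistrib del: transpose_matrix_vector)
    ultimately show "\<exists>Z. (Z - Z\<^sub>0) \<bullet> ((Z - Z\<^sub>0) ** R) \<le> s \<and> transpose Z *v v = y"
      by (intro exI[of _ "Z\<^sub>0 + O1"]) (simp add: O3 e_def del: transpose_matrix_vector)
  qed
qed

section \<open>The linear matrix inequality as a quadratic form inequality\<close>

lemma block_identity_form:
  fixes Y :: "real^'n^'n" and C :: "real^'n^'p"
  shows "vjoin w q \<bullet> (block_mat Y (transpose C) C (mat 1) *v vjoin w q) =
    w \<bullet> ((Y - transpose C ** C) *v w) + (q + C *v w) \<bullet> (q + C *v w)"
proof -
  have "w \<bullet> (transpose C *v q) = (C *v w) \<bullet> q"
    by (rule inner_matrix_transpose[symmetric])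
  moreover have "w \<bullet> (transpose C *v (C *v w)) = (C *v w) \<bullet> (C *v w)"
    by (rule inner_matrix_transpose[symmetric])
  ultimately show ?thesis
    by (simp add: block_mat_mult_vjoin matrix_vector_mult_diff_rdistrib inner_add_left inner_add_right
        inner_diff_right inner_commute matrix_vector_mul_assoc[symmetric] del: transpose_matrix_vector)
qed

text \<open>Minimizing over the last block, with q = - C w, leaves the Schur complement of the
  identity. Thus the second inequality of the theorem says exactly that (Y, L) lies in
  \<open>Theta_Hinf\<close>.\<close>

lemma pos_def_block_identity_iff:
  fixes Y :: "real^'n^'n" and C :: "real^'n^'p"
  assumes "sym_mat Y"
  shows "pos_def (block_mat Y (transpose C) C (mat 1)) \<longleftrightarrow> pos_def (Y - transpose C ** C)"
    (is "pos_def ?B \<longleftrightarrow> pos_def ?P")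
proof -
  have sym: "sym_mat ?B" "sym_mat ?P"
    using assms by (simp_all add: sym_mat_block_mat)
      (simp_all add: sym_mat_def transpose_diff matrix_transpose_mul)
  show ?thesis
  proof
    assume B: "pos_def ?B"
    have "w \<bullet> (?P *v w) > 0" if "w \<noteq> 0" for w
    proof -
      have "vjoin w (- (C *v w)) \<bullet> (?B *v vjoin w (- (C *v w))) > 0"
        using B that by (simp add: pos_def_def vjoin_eq_0_iff)
      then show ?thesis unfolding block_identity_form by simp
    qed
    then show "pos_def ?P" using sym by (simp add: pos_def_def)
  next
    assume P: "pos_def ?P"
    have "x \<bullet> (?B *v x) > 0" if "x \<noteq> 0" for x
    proof -
      obtain w q where x: "x = vjoin w q" by (rule vjoin_cases)
      show ?thesis
      proof (cases "w = 0")
        case True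
        with that have "q \<noteq> 0" by (simp add: x vjoin_eq_0_iff)
        then show ?thesis unfolding x block_identity_form True by simp
      next
        case False
        then have "w \<bullet> (?P *v w) > 0" using P by (simp add: pos_def_def)
        then show ?thesis unfolding x block_identity_form by (simp add: add_pos_nonneg)
      qed
    qed
    then show "pos_def ?B" using sym by (simp add: pos_def_def)
  qed
qed

lemma M_Hinf_form:
  fixes Y :: "real^'n^'n" and L :: "real^'n^'m" and C :: "real^'n^'p"
  shows "vjoin v y \<bullet> (M_Hinf \<gamma> C D (Y, L) *v vjoin v y) =
    v \<bullet> (Y *v v) - (1 / \<gamma>\<^sup>2) * (v \<bullet> v)
    - (transpose (stack Y L) *v y) \<bullet> (matrix_inv (Y - transpose (C_YL C D Y L) ** C_YL C D Y L) *v
        (transpose (stack Y L) *v y))"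
  unfolding M_Hinf_def case_prod_conv block_mat_mult_vjoin inner_vjoin matrix_minus_mult_vec
    matrix_vector_mul_assoc[symmetric] inner_minus_right
    matrix_vector_mult_diff_rdistrib scaleR_matrix_vector_assoc[symmetric]
  by (simp add: matrix_vector_mult_diff_rdistrib scaleR_matrix_vector_assoc[symmetric] inner_diff_right
      inner_minus_right del: transpose_matrix_vector)
    (simp only: inner_transpose_matrix[of y "stack Y L"])

lemma sym_mat_LMI_mat:
  assumes "sym_mat Y" "sym_mat Q"
  shows "sym_mat (LMI_mat \<gamma> C D Q Y L \<alpha> \<beta>)"
proof -
  have "transpose (stack Y L) = beside Y (transpose L)"
    using assms(1) by (simp add: transpose_stack sym_mat_def)
  moreover have "transpose (beside Y (transpose L)) = stack Y L"
    using assms(1) by (simp add: transpose_beside sym_mat_def)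
  ultimately show ?thesis
    using assms by (simp add: sym_mat_def LMI_mat_def transpose_diff transpose_scaleR transpose_block_mat)
qed

lemma LMI_mat_form:
  fixes Y :: "real^'n^'n" and L :: "real^'n^'m" and C :: "real^'n^'p"
  assumes "sym_mat Y"
  shows "vjoin (vjoin v y) (vjoin w q) \<bullet> (LMI_mat \<gamma> C D Q Y L \<alpha> \<beta> *v vjoin (vjoin v y) (vjoin w q)) =
    v \<bullet> (Y *v v) - (1 / \<gamma>\<^sup>2) * (v \<bullet> v) - \<beta> * (v \<bullet> v) - \<alpha> * (vjoin v y \<bullet> (Q *v vjoin v y))
    + 2 * (w \<bullet> (transpose (stack Y L) *v y))
    + w \<bullet> ((Y - transpose (C_YL C D Y L) ** C_YL C D Y L) *v w)
    + (q + C_YL C D Y L *v w) \<bullet> (q + C_YL C D Y L *v w)"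
proof -
  have S: "beside Y (transpose L) = transpose (stack Y L)"
    using assms by (simp add: transpose_stack sym_mat_def)
  have "y \<bullet> (stack Y L *v w) = w \<bullet> (transpose (stack Y L) *v y)"
    unfolding inner_transpose_matrix[of y] by (rule inner_commute)
  then have 1: "vjoin (vjoin v y) (vjoin w q) \<bullet> (LMI_mat \<gamma> C D Q Y L \<alpha> \<beta> *v vjoin (vjoin v y) (vjoin w q)) =
    v \<bullet> (Y *v v) - (1 / \<gamma>\<^sup>2) * (v \<bullet> v) - \<beta> * (v \<bullet> v) - \<alpha> * (vjoin v y \<bullet> (Q *v vjoin v y))
    + 2 * (w \<bullet> (transpose (stack Y L) *v y))
    + vjoin w q \<bullet> (block_mat Y (transpose (C_YL C D Y L)) (C_YL C D Y L) (mat 1) *v vjoin w q)"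
    unfolding LMI_mat_def matrix_vector_mult_diff_rdistrib scaleR_matrix_vector_assoc[symmetric]
      inner_diff_right inner_scaleR_right block_mat_mult_vjoin inner_vjoin S vjoin_add inner_add_right
    by (simp add: inner_add_right inner_diff_right del: transpose_matrix_vector)
  show ?thesis unfolding 1 block_identity_form by simp
qed

text \<open>Minimize over q, then over w. The first minimum is 0 and the second contributes - z^T
  P^-1 z, the inverse term of \<open>M_Hinf\<close> that the larger inequality avoids.\<close>

lemma pos_semidef_LMI_mat_iff:
  fixes Y :: "real^'n^'n" and L :: "real^'n^'m" and C :: "real^'n^'p"
  assumes Y: "sym_mat Y" and Q: "sym_mat Q"
    and P: "pos_def (Y - transpose (C_YL C D Y L) ** C_YL C D Y L)"
  shows "pos_semidef (LMI_mat \<gamma> C D Q Y L \<alpha> \<beta>) \<longleftrightarrow>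
    (\<forall>v y. \<alpha> * (vjoin v y \<bullet> (Q *v vjoin v y)) + \<beta> * (v \<bullet> v) \<le>
      vjoin v y \<bullet> (M_Hinf \<gamma> C D (Y, L) *v vjoin v y))"
    (is "_ \<longleftrightarrow> (\<forall>v y. ?form v y)")
proof -
  let ?P = "Y - transpose (C_YL C D Y L) ** C_YL C D Y L"
  have P': "pos_semidef ?P" using P by (rule pos_def_imp_pos_semidef)
  show ?thesis
  proof
    assume LMI: "pos_semidef (LMI_mat \<gamma> C D Q Y L \<alpha> \<beta>)"
    show "\<forall>v y. ?form v y"
    proof (intro allI)
      fix v y
      define z where "z = transpose (stack Y L) *v y"
      define w where "w = - (matrix_inv ?P *v z)"
      define q where "q = - (C_YL C D Y L *v w)"
      have "0 \<le> vjoin (vjoin v y) (vjoin w q) \<bullet> (LMI_mat \<gamma> C D Q Y L \<alpha> \<beta> *v vjoin (vjoin v y) (vjoin w q))"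
        using LMI unfolding pos_semidef_def by blast
      moreover have "q + C_YL C D Y L *v w = 0" by (simp add: q_def)
      moreover have "w \<bullet> (?P *v w) + 2 * (w \<bullet> z) + z \<bullet> (matrix_inv ?P *v z) = 0"
        unfolding complete_square[OF P] by (simp add: w_def)
      ultimately show "?form v y"
        unfolding LMI_mat_form[OF Y] M_Hinf_form z_def[symmetric] by simp
    qed
  next
    assume form: "\<forall>v y. ?form v y"
    have "0 \<le> x \<bullet> (LMI_mat \<gamma> C D Q Y L \<alpha> \<beta> *v x)" for x
    proof -
      obtain a b where x: "x = vjoin a b" by (rule vjoin_cases)
      obtain v y where a: "a = vjoin v y" by (rule vjoin_cases)
      obtain w q where b: "b = vjoin w q" by (rule vjoin_cases)
      define z where "z = transpose (stack Y L) *v y"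
      have "w \<bullet> (?P *v w) + 2 * (w \<bullet> z) + z \<bullet> (matrix_inv ?P *v z) \<ge> 0"
        unfolding complete_square[OF P] using P' by (simp add: pos_semidef_def)
      moreover have "?form v y" using form by blast
      moreover have "(q + C_YL C D Y L *v w) \<bullet> (q + C_YL C D Y L *v w) \<ge> 0" by simp
      ultimately show ?thesis
        unfolding x a b LMI_mat_form[OF Y] M_Hinf_form z_def[symmetric] by linarith
    qed
    then show "pos_semidef (LMI_mat \<gamma> C D Q Y L \<alpha> \<beta>)"
      using sym_mat_LMI_mat[OF Y Q] by (simp add: pos_semidef_def)
  qed
qed

section \<open>Stability and the H-infinity bound\<close>

definition re_vec :: "complex^'n \<Rightarrow> real^'n" where
  "re_vec a = (\<chi> i. Re (a $ i))"

definition im_vec :: "complex^'n \<Rightarrow> real^'n" where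
  "im_vec a = (\<chi> i. Im (a $ i))"

lemma re_im_complex_mat:
  "re_vec (complex_mat A *v a) = A *v re_vec a" "im_vec (complex_mat A *v a) = A *v im_vec a"
  by (simp_all add: re_vec_def im_vec_def complex_mat_def matrix_vector_mult_def vec_eq_iff)

lemma re_im_scale:
  "re_vec (z *s a) = Re z *\<^sub>R re_vec a - Im z *\<^sub>R im_vec a"
  "im_vec (z *s a) = Re z *\<^sub>R im_vec a + Im z *\<^sub>R re_vec a"
  by (simp_all add: re_vec_def im_vec_def vec_eq_iff)

lemma re_im_diff: "re_vec (a - b) = re_vec a - re_vec b" "im_vec (a - b) = im_vec a - im_vec b"
  by (simp_all add: re_vec_def im_vec_def vec_eq_iff)

lemma norm_complex_vec: "(norm (a :: complex^'n))\<^sup>2 = (norm (re_vec a))\<^sup>2 + (norm (im_vec a))\<^sup>2"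
  unfolding power2_norm_eq_inner
  by (simp add: inner_vec_def inner_complex_def re_vec_def im_vec_def sum.distrib)

lemma re_im_eq_0_iff: "re_vec a = 0 \<and> im_vec a = 0 \<longleftrightarrow> a = 0"
  by (auto simp: re_vec_def im_vec_def vec_eq_iff complex_eq_iff)

text \<open>The real quadratic forms are applied separately to real and imaginary parts; the storage
  function \<open>a \<bullet> X a\<close> is multiplied by \<open>|z|\<^sup>2\<close> along \<open>a \<mapsto> z a\<close>.\<close>

lemma dissipation_complex:
  fixes F X :: "real^'n^'n" and H :: "real^'n^'p" and a :: "complex^'n"
  assumes X: "pos_def X"
    and diss: "\<And>a b. (norm (H *v a))\<^sup>2 + \<kappa> * (norm (X *v b))\<^sup>2 \<le>
      a \<bullet> (X *v a) - b \<bullet> (X *v b) + 2 * ((X *v b) \<bullet> (b - F *v a))"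
  defines "E \<equiv> re_vec a \<bullet> (X *v re_vec a) + im_vec a \<bullet> (X *v im_vec a)"
  shows "E \<ge> 0"
    and "(norm (complex_mat H *v a))\<^sup>2 + \<kappa> * (norm (complex_mat X *v (z *s a)))\<^sup>2 \<le>
      (1 - (cmod z)\<^sup>2) * E + 2 * norm (complex_mat X *v (z *s a)) * norm (z *s a - complex_mat F *v a)"
proof -
  define b where "b = z *s a"
  define w where "w = z *s a - complex_mat F *v a"
  define p where "p = complex_mat X *v b"
  have X': "pos_semidef X" using X by (rule pos_def_imp_pos_semidef)
  then show "E \<ge> 0" by (simp add: E_def pos_semidef_def)
  have xy: "re_vec a \<bullet> (X *v im_vec a) = im_vec a \<bullet> (X *v re_vec a)"
    using X by (intro sym_mat_inner) (simp add: pos_def_def)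
  have b: "re_vec b \<bullet> (X *v re_vec b) + im_vec b \<bullet> (X *v im_vec b) = (cmod z)\<^sup>2 * E"
    unfolding b_def re_im_scale E_def cmod_power2
    using xy by (simp add: matrix_vector_right_distrib matrix_vector_mult_diff_distrib
        matrix_vector_mult_scaleR inner_add_left inner_add_right inner_diff_left inner_diff_right
        power2_eq_square algebra_simps)
  have w: "re_vec b - F *v re_vec a = re_vec w" "im_vec b - F *v im_vec a = im_vec w"
    by (simp_all add: w_def b_def re_im_diff re_im_complex_mat)
  have p: "re_vec p = X *v re_vec b" "im_vec p = X *v im_vec b"
    by (simp_all add: p_def re_im_complex_mat)
  \<comment> \<open>The real inner product on complex vectors is the real part of the Hermitian one,
    so a single Cauchy-Schwarz estimate covers both parts.\<close>
  have "re_vec p \<bullet> re_vec w + im_vec p \<bullet> im_vec w = p \<bullet> w"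
    by (simp add: inner_vec_def re_vec_def im_vec_def inner_complex_def sum.distrib)
  also have "\<dots> \<le> norm p * norm w" by (rule norm_cauchy_schwarz)
  finally have pw: "(X *v re_vec b) \<bullet> re_vec w + (X *v im_vec b) \<bullet> im_vec w \<le> norm p * norm w"
    unfolding p .
  have np: "\<kappa> * (norm p)\<^sup>2 = \<kappa> * (norm (X *v re_vec b))\<^sup>2 + \<kappa> * (norm (X *v im_vec b))\<^sup>2"
    unfolding norm_complex_vec[of p] p by (rule distrib_left)
  have nH: "(norm (complex_mat H *v a))\<^sup>2 = (norm (H *v re_vec a))\<^sup>2 + (norm (H *v im_vec a))\<^sup>2"
    unfolding norm_complex_vec re_im_complex_mat ..
  have "(1 - (cmod z)\<^sup>2) * E = E - (cmod z)\<^sup>2 * E" by (simp add: algebra_simps)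
  then have "(norm (complex_mat H *v a))\<^sup>2 + \<kappa> * (norm p)\<^sup>2 \<le> (1 - (cmod z)\<^sup>2) * E + 2 * (norm p * norm w)"
    using diss[of "re_vec a" "re_vec b"] diss[of "im_vec a" "im_vec b"] b pw
    unfolding np nH w by (simp only: E_def)
  then show "(norm (complex_mat H *v a))\<^sup>2 + \<kappa> * (norm (complex_mat X *v (z *s a)))\<^sup>2 \<le>
      (1 - (cmod z)\<^sup>2) * E + 2 * norm (complex_mat X *v (z *s a)) * norm (z *s a - complex_mat F *v a)"
    by (simp add: p_def b_def w_def)
qed

text \<open>For an eigenvector a with |z| \<ge> 1, take b = z a = F a: the supply term vanishes and
  the storage does not decrease, so X b = 0, contradicting the definiteness of
  \<open>X\<close>.\<close>

lemma stable_if_dissipation: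
  fixes F X :: "real^'n^'n" and H :: "real^'n^'p"
  assumes X: "pos_def X" and \<kappa>: "\<kappa> > 0"
    and diss: "\<And>a b. (norm (H *v a))\<^sup>2 + \<kappa> * (norm (X *v b))\<^sup>2 \<le>
      a \<bullet> (X *v a) - b \<bullet> (X *v b) + 2 * ((X *v b) \<bullet> (b - F *v a))"
  shows "stable_mat F"
  unfolding stable_mat_def
proof (intro allI impI, elim exE conjE, rule ccontr)
  fix z :: complex and a
  assume a: "a \<noteq> 0" "complex_mat F *v a = z *s a" and "\<not> cmod z < 1"
  then have "(cmod z)\<^sup>2 \<ge> 1" by simp
  let ?E = "re_vec a \<bullet> (X *v re_vec a) + im_vec a \<bullet> (X *v im_vec a)"
  let ?p = "complex_mat X *v (z *s a)"
  have "(1 - (cmod z)\<^sup>2) * ?E \<le> 0"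
    using dissipation_complex(1)[OF X diss] \<open>(cmod z)\<^sup>2 \<ge> 1\<close> by (simp add: mult_nonpos_nonneg)
  then have "(norm (complex_mat H *v a))\<^sup>2 + \<kappa> * (norm ?p)\<^sup>2 \<le> 0"
    using dissipation_complex(2)[OF X diss, of a z] a(2) by simp
  moreover have "(norm (complex_mat H *v a))\<^sup>2 \<ge> 0" "\<kappa> * (norm ?p)\<^sup>2 \<ge> 0" using \<kappa> by simp_all
  ultimately have "\<kappa> * (norm ?p)\<^sup>2 = 0" by linarith
  then have "?p = 0" using \<kappa> by simp
  then have "X *v re_vec (z *s a) = 0" "X *v im_vec (z *s a) = 0"
    unfolding re_im_complex_mat[symmetric] by (simp_all add: re_vec_def im_vec_def vec_eq_iff)
  then have "re_vec (z *s a) = 0" "im_vec (z *s a) = 0"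
    using X unfolding pos_def_def by (metis inner_zero_right less_irrefl)+
  then have "z *s a = 0" using re_im_eq_0_iff by blast
  then show False using a(1) \<open>\<not> cmod z < 1\<close> by (auto simp: vec_eq_iff)
qed

text \<open>With a = (z I - F)^-1 w and b = z a the supply is driven by w alone, and for |z| > 1 the
  storage term is nonpositive. What remains is at most 2 p |w| - \<kappa> p^2, whose maximum over p
  is |w|^2 / \<kappa>.\<close>

lemma onorm_transfer_le:
  fixes F X :: "real^'n^'n" and H :: "real^'n^'p"
  assumes X: "pos_def X" and \<kappa>: "\<kappa> > 0" and z: "cmod z > 1"
    and diss: "\<And>a b. (norm (H *v a))\<^sup>2 + \<kappa> * (norm (X *v b))\<^sup>2 \<le>
      a \<bullet> (X *v a) - b \<bullet> (X *v b) + 2 * ((X *v b) \<bullet> (b - F *v a))"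
  shows "onorm ((*v) (complex_mat H ** matrix_inv (mat z - complex_mat F))) \<le> 1 / sqrt \<kappa>"
proof (rule onorm_le)
  fix w :: "complex^'n"
  let ?R = "mat z - complex_mat F"
  have Ra: "?R *v a = z *s a - complex_mat F *v a" for a
    by (simp add: matrix_vector_mult_diff_rdistrib)
      (simp add: vec_eq_iff mat_def matrix_vector_mult_def if_distrib if_distribR cong: if_cong)
  have "a = 0" if "?R *v a = 0" for a
  proof (rule ccontr)
    assume "a \<noteq> 0"
    moreover have "complex_mat F *v a = z *s a" using that by (simp add: Ra)
    ultimately have "cmod z < 1"
      using stable_if_dissipation[OF X \<kappa> diss] unfolding stable_mat_def by blast
    with z show False by simp
  qed
  then have "invertible ?R"
    by (simp add: invertible_left_inverse matrix_left_invertible_ker)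
  then have inv: "?R ** matrix_inv ?R = mat 1"
    unfolding invertible_def matrix_inv_def by (metis (mono_tags, lifting) someI_ex)
  define a where "a = matrix_inv ?R *v w"
  have w: "z *s a - complex_mat F *v a = w"
    unfolding Ra[symmetric] by (simp add: a_def matrix_vector_mul_assoc inv)
  let ?E = "re_vec a \<bullet> (X *v re_vec a) + im_vec a \<bullet> (X *v im_vec a)"
  define p where "p = norm (complex_mat X *v (z *s a))"
  have "(1 - (cmod z)\<^sup>2) * ?E \<le> 0"
    using dissipation_complex(1)[OF X diss] z by (simp add: mult_nonpos_nonneg)
  then have "(norm (complex_mat H *v a))\<^sup>2 \<le> 2 * p * norm w - \<kappa> * p\<^sup>2"
    using dissipation_complex(2)[OF X diss, of a z] by (simp add: w p_def)
  also have "\<dots> = (norm w)\<^sup>2 / \<kappa> - (\<kappa> * p - norm w)\<^sup>2 / \<kappa>"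
  proof -
    have "\<kappa> * (2 * p * norm w - \<kappa> * p\<^sup>2) = (norm w)\<^sup>2 - (\<kappa> * p - norm w)\<^sup>2"
      by (simp add: power2_eq_square algebra_simps)
    then show ?thesis
      using \<kappa> by (simp add: diff_divide_distrib[symmetric] nonzero_eq_divide_eq mult.commute)
  qed
  also have "\<dots> \<le> (norm w)\<^sup>2 / \<kappa>"
    using \<kappa> by simp
  also have "\<dots> = (1 / sqrt \<kappa> * norm w)\<^sup>2"
    using \<kappa> by (simp add: power_mult_distrib power_divide)
  finally have "norm (complex_mat H *v a) \<le> 1 / sqrt \<kappa> * norm w"
    by (rule power2_le_imp_le) (use \<kappa> in simp)
  then show "norm ((complex_mat H ** matrix_inv ?R) *v w) \<le> 1 / sqrt \<kappa> * norm w"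
    by (simp add: a_def matrix_vector_mul_assoc)
qed

text \<open>The form inequality is evaluated at \<open>v = X b\<close> and at the completing vector
  \<open>w = - X a\<close>, where \<open>X = Y\<^sup>-\<^sup>1\<close>.\<close>

lemma dissipation_of_M_Hinf:
  fixes Y :: "real^'n^'n" and L :: "real^'n^'m" and C :: "real^'n^'p" and B :: "real^'m^'n"
  assumes Y: "pos_def Y"
    and P: "pos_def (Y - transpose (C_YL C D Y L) ** C_YL C D Y L)"
    and form: "\<And>v. \<beta> * (v \<bullet> v) \<le> vjoin v (transpose (beside A B) *v v) \<bullet>
      (M_Hinf \<gamma> C D (Y, L) *v vjoin v (transpose (beside A B) *v v))"
  defines "X \<equiv> matrix_inv Y"
  defines "K \<equiv> L ** X"
  shows "(norm ((C + D ** K) *v a))\<^sup>2 + (1 / \<gamma>\<^sup>2 + \<beta>) * (norm (X *v b))\<^sup>2 \<le>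
    a \<bullet> (X *v a) - b \<bullet> (X *v b) + 2 * ((X *v b) \<bullet> (b - (A + B ** K) *v a))"
proof -
  let ?G = "C_YL C D Y L"
  let ?P = "Y - transpose ?G ** ?G"
  define v where "v = X *v b"
  define w where "w = - (X *v a)"
  define z where "z = transpose (stack Y L) *v (transpose (beside A B) *v v)"
  have YX: "Y ** X = mat 1" unfolding X_def by (rule pos_def_matrix_inv_mult[OF Y])
  have YXv: "Y *v (X *v c) = c" for c
    by (simp add: matrix_vector_mul_assoc YX)
  \<comment> \<open>Here the gain appears: [Y; L] Y^-1 = [I; K] closes the loop.\<close>
  have "beside A B ** stack Y L ** X = A + B ** K"
    unfolding beside_mult_stack K_def
    by (simp add: matrix_add_rdistrib matrix_mul_assoc[symmetric] YX)
  then have "w \<bullet> z = - (((A + B ** K) *v a) \<bullet> v)"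
    unfolding z_def w_def inner_minus_left inner_matrix_transpose[symmetric]
    by (simp add: matrix_vector_mul_assoc matrix_mul_assoc vec.neg)
  moreover have "?G ** X = C + D ** K"
    unfolding C_YL_def K_def by (simp add: matrix_add_rdistrib matrix_mul_assoc[symmetric] YX)
  then have Gw: "?G *v w = - ((C + D ** K) *v a)"
    by (simp add: w_def vec.neg matrix_vector_mul_assoc)
  have "w \<bullet> (?P *v w) = a \<bullet> (X *v a) - (norm ((C + D ** K) *v a))\<^sup>2"
  proof -
    have "w \<bullet> (?P *v w) = w \<bullet> (Y *v w) - (?G *v w) \<bullet> (?G *v w)"
      unfolding inner_matrix_transpose[of ?G] by (simp add: matrix_vector_mult_diff_rdistrib inner_diff_right
          matrix_vector_mul_assoc)
    also have "w \<bullet> (Y *v w) = a \<bullet> (X *v a)"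
      by (simp add: w_def vec.neg YXv inner_commute)
    finally show ?thesis by (simp add: Gw power2_norm_eq_inner)
  qed
  moreover have "w \<bullet> (?P *v w) + 2 * (w \<bullet> z) + z \<bullet> (matrix_inv ?P *v z) \<ge> 0"
    unfolding complete_square[OF P] using pos_def_imp_pos_semidef[OF P] by (simp add: pos_semidef_def)
  moreover have "\<beta> * (v \<bullet> v) \<le> v \<bullet> (Y *v v) - (1 / \<gamma>\<^sup>2) * (v \<bullet> v) - z \<bullet> (matrix_inv ?P *v z)"
    using form[of v] unfolding M_Hinf_form z_def .
  moreover have "v \<bullet> (Y *v v) = b \<bullet> (X *v b)"
    by (simp add: v_def YXv inner_commute)
  moreover have "(X *v b) \<bullet> (b - (A + B ** K) *v a) = b \<bullet> (X *v b) - ((A + B ** K) *v a) \<bullet> v"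
    by (simp add: inner_diff_right v_def inner_commute)
  moreover have "(1 / \<gamma>\<^sup>2 + \<beta>) * (norm v)\<^sup>2 = (1 / \<gamma>\<^sup>2) * (v \<bullet> v) + \<beta> * (v \<bullet> v)"
    unfolding power2_norm_eq_inner by (rule distrib_right)
  ultimately show ?thesis
    unfolding v_def[symmetric] by linarith
qed

section \<open>Informativity\<close>

lemma informative_form_iff:
  fixes u :: "nat \<Rightarrow> real^'m" and x :: "nat \<Rightarrow> real^'n" and C :: "real^'n^'p"
    and \<W> :: "(real^('t::{finite,linorder})^'n) set"
  shows "informative u x \<W> (Theta_Hinf C D) (M_Hinf \<gamma> C D) \<longleftrightarrow>
    (\<exists>Y L. (Y, L) \<in> Theta_Hinf C D \<and> (\<forall>(A, B)\<in>compatible_systems u x \<W>. \<forall>v. v \<noteq> 0 \<longrightarrow>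
      vjoin v (transpose (beside A B) *v v) \<bullet> (M_Hinf \<gamma> C D (Y, L) *v vjoin v (transpose (beside A B) *v v)) > 0))"
proof -
  have sym: "sym_mat (M_Hinf \<gamma> C D \<theta>)" if \<theta>: "\<theta> \<in> Theta_Hinf C D" for \<theta>
  proof -
    obtain Y L where YL: "\<theta> = (Y, L)" by (cases \<theta>)
    have "sym_mat (blk22 (M_Hinf \<gamma> C D \<theta>))"
      using M_Hinf_neg_semidef[OF \<theta>]
      by (simp add: neg_semidef_def pos_semidef_def sym_mat_def transpose_minus)
    then show ?thesis
      using \<theta> by (simp add: YL M_Hinf_def Theta_Hinf_def sym_mat_block_mat)
        (simp add: sym_mat_def transpose_diff transpose_scaleR)
  qed
  have "pos_def (transpose S ** M ** S) \<longleftrightarrow> (\<forall>v. v \<noteq> 0 \<longrightarrow> (S *v v) \<bullet> (M *v (S *v v)) > 0)"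
    if "sym_mat M" for M :: "real^('n + ('n + 'm))^('n + ('n + 'm))" and S :: "real^'n^('n + ('n + 'm))"
    using sym_mat_congruence[OF that, of S] by (simp add: pos_def_def inner_congruence)
  moreover have "stack (mat 1) (stack (transpose A) (transpose B)) *v v = vjoin v (transpose (beside A B) *v v)"
    for A :: "real^'n^'n" and B :: "real^'m^'n" and v
    by (simp add: stack_mult_vec transpose_beside del: transpose_matrix_vector)
  ultimately show ?thesis
    using sym unfolding informative_def Let_def split_beta
    by (simp add: Bex_def split_paired_Ex cong: conj_cong del: transpose_matrix_vector)
qed

text \<open>The margin \<open>\<epsilon>\<close> relaxes the constraint to one that has a Slater point even in the
  degenerate case \<open>s = 0\<close>, so the S-lemma applies without a regularity assumption.\<close>

lemma multiplier_exists:
  fixes H :: "real^'n^'n" and K R :: "real^'k^'k" and G :: "real^'n^'k"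
    and M Q :: "real^('n + 'k)^('n + 'k)"
  assumes K: "pos_semidef K" and R: "pos_semidef R" and s: "s \<ge> 0"
    and M: "\<And>v y. vjoin v y \<bullet> (M *v vjoin v y) = v \<bullet> (H *v v) - y \<bullet> (K *v y)" and symM: "sym_mat M"
    and Q: "\<And>v y. vjoin v y \<bullet> (Q *v vjoin v y) = s * (v \<bullet> v) - (y - G *v v) \<bullet> (R *v (y - G *v v))"
    and symQ: "sym_mat Q"
    and pos: "\<And>v y. v \<noteq> 0 \<Longrightarrow> vjoin v y \<bullet> (Q *v vjoin v y) \<ge> 0 \<Longrightarrow> vjoin v y \<bullet> (M *v vjoin v y) > 0"
  obtains \<alpha> \<beta> where "\<alpha> \<ge> 0" "\<beta> > 0" "\<And>v y. \<alpha> * (vjoin v y \<bullet> (Q *v vjoin v y)) + \<beta> * (v \<bullet> v) \<le> vjoin v y \<bullet> (M *v vjoin v y)"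
proof -
  have "v \<bullet> (H *v v) - (G *v v + e) \<bullet> (K *v (G *v v + e)) > 0"
    if "v \<noteq> 0" "e \<bullet> (R *v e) \<le> s * (v \<bullet> v)" for v e
    using pos[of v "G *v v + e"] that by (simp add: M Q)
  from strict_inequality_margin[OF K R s this] obtain \<epsilon> where \<epsilon>: "\<epsilon> > 0"
    and eps: "\<And>v e. e \<bullet> (R *v e) \<le> (s + \<epsilon>) * (v \<bullet> v) \<Longrightarrow>
      v \<bullet> (H *v v) - (G *v v + e) \<bullet> (K *v (G *v v + e)) \<ge> \<epsilon> * (v \<bullet> v)"
    by blast
  define J :: "real^('n + 'k)^('n + 'k)" where "J = block_mat (mat 1) 0 0 0"
  have J: "vjoin v y \<bullet> (J *v vjoin v y) = v \<bullet> v" for v y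
    by (simp add: J_def block_mat_mult_vjoin)
  have symJ: "sym_mat J"
    by (simp add: J_def sym_mat_def transpose_block_mat)
  \<comment> \<open>The \<epsilon> moves to both sides: f carries the margin to be proved, and g the
    enlarged constraint, which is strict at the centre y = G v of any nonzero v.\<close>
  define f where "f z = z \<bullet> ((M - \<epsilon> *\<^sub>R J) *v z)" for z
  define g where "g z = z \<bullet> ((Q + \<epsilon> *\<^sub>R J) *v z)" for z
  have f: "f (vjoin v y) = vjoin v y \<bullet> (M *v vjoin v y) - \<epsilon> * (v \<bullet> v)" for v y
    by (simp add: f_def matrix_vector_mult_diff_rdistrib scaleR_matrix_vector_assoc[symmetric]
        inner_diff_right J)
  have g: "g (vjoin v y) = vjoin v y \<bullet> (Q *v vjoin v y) + \<epsilon> * (v \<bullet> v)" for v y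
    by (simp add: g_def matrix_vector_mult_add_rdistrib scaleR_matrix_vector_assoc[symmetric]
        inner_add_right J)
  have quad: "(z + t *\<^sub>R z') \<bullet> (A *v (z + t *\<^sub>R z')) =
      z \<bullet> (A *v z) + t * (2 * (z \<bullet> (A *v z'))) + t\<^sup>2 * (z' \<bullet> (A *v z'))"
    if "sym_mat A" for A :: "real^('n + 'k)^('n + 'k)" and z z' t
    using sym_mat_inner[OF that, of z' z]
    by (simp add: matrix_vector_right_distrib matrix_vector_mult_scaleR inner_add_left inner_add_right
        power2_eq_square distrib_left)
  have sym: "sym_mat (M - \<epsilon> *\<^sub>R J)" "sym_mat (Q + \<epsilon> *\<^sub>R J)"
    using symM symQ symJ by (simp_all add: sym_mat_def transpose_diff transpose_add transpose_scaleR)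
  have fg: "f z \<ge> 0" if gz: "g z \<ge> 0" for z
  proof -
    obtain v y where z: "z = vjoin v y" by (rule vjoin_cases)
    have "(y - G *v v) \<bullet> (R *v (y - G *v v)) \<le> (s + \<epsilon>) * (v \<bullet> v)"
      using gz by (simp add: z g Q distrib_right)
    from eps[OF this] show ?thesis by (simp add: z f M)
  qed
  obtain v\<^sub>0 :: "real^'n" where v0: "v\<^sub>0 \<noteq> 0" using one_neq_zero by blast
  have "g (vjoin v\<^sub>0 (G *v v\<^sub>0)) = s * (v\<^sub>0 \<bullet> v\<^sub>0) + \<epsilon> * (v\<^sub>0 \<bullet> v\<^sub>0)"
    by (simp add: g Q)
  also have "\<dots> > 0" using v0 \<epsilon> s by (simp add: add_nonneg_pos)
  finally have slater: "g (vjoin v\<^sub>0 (G *v v\<^sub>0)) > 0" .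
  obtain \<alpha> where \<alpha>: "\<alpha> \<ge> 0" "\<And>z. f z \<ge> \<alpha> * g z"
    using S_lemma[where f = f and g = g, OF quad[OF sym(1), folded f_def] quad[OF sym(2), folded g_def] fg slater]
    by blast
  show thesis
  proof (rule that[OF \<alpha>(1) \<epsilon>])
    fix v :: "real^'n" and y :: "real^'k"
    have "\<alpha> * (\<epsilon> * (v \<bullet> v)) \<ge> 0" using \<alpha>(1) \<epsilon> by simp
    then show "\<alpha> * (vjoin v y \<bullet> (Q *v vjoin v y)) + \<epsilon> * (v \<bullet> v) \<le> vjoin v y \<bullet> (M *v vjoin v y)"
      using \<alpha>(2)[of "vjoin v y"] unfolding f g distrib_left by linarith
  qed
qed

text \<open>The supremum only yields a weak bound, by 1 / sqrt \<kappa>. Since \<kappa> exceeds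
  1/\<gamma>^2 by \<beta>, that bound is itself below \<gamma>.\<close>

lemma Hinf_norm_less:
  fixes Y :: "real^'n^'n" and L :: "real^'n^'m" and C :: "real^'n^'p" and B :: "real^'m^'n"
  assumes Y: "pos_def Y" and \<gamma>: "\<gamma> > 0" and \<beta>: "\<beta> > 0"
    and P: "pos_def (Y - transpose (C_YL C D Y L) ** C_YL C D Y L)"
    and form: "\<And>v. \<beta> * (v \<bullet> v) \<le> vjoin v (transpose (beside A B) *v v) \<bullet>
      (M_Hinf \<gamma> C D (Y, L) *v vjoin v (transpose (beside A B) *v v))"
  shows "stable_mat (A + B ** (L ** matrix_inv Y))"
    and "Hinf_norm (closed_loop_transfer C D A B (L ** matrix_inv Y)) < ereal \<gamma>"
proof -
  define X where "X = matrix_inv Y"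
  define \<kappa> where "\<kappa> = 1 / \<gamma>\<^sup>2 + \<beta>"
  have \<kappa>: "\<kappa> > 0" "\<kappa> > (1 / \<gamma>)\<^sup>2" using \<gamma> \<beta> by (simp_all add: \<kappa>_def add_pos_pos power_divide)
  have inv: "Y ** X = mat 1" unfolding X_def by (rule pos_def_matrix_inv_mult[OF Y])
  have X: "pos_def X"
  proof -
    have X': "pos_semidef X" unfolding X_def by (rule pos_def_matrix_inv[OF Y])
    have "v \<bullet> (X *v v) \<noteq> 0" if "v \<noteq> 0" for v
    proof
      assume "v \<bullet> (X *v v) = 0"
      then have "X *v v = 0" by (rule pos_semidef_inner_eq_0[OF X'])
      then have "(Y ** X) *v v = 0" by (simp add: matrix_vector_mul_assoc[symmetric])
      with that show False by (simp add: inv)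
    qed
    moreover have "v \<bullet> (X *v v) \<ge> 0" for v using X' by (simp add: pos_semidef_def)
    ultimately show ?thesis
      using X' by (simp add: pos_def_def pos_semidef_def order_less_le eq_commute[of 0])
  qed
  note diss = dissipation_of_M_Hinf[OF Y P form, folded X_def \<kappa>_def]
  show "stable_mat (A + B ** (L ** matrix_inv Y))"
    unfolding X_def[symmetric] by (rule stable_if_dissipation[OF X \<kappa>(1) diss])
  have "Hinf_norm (closed_loop_transfer C D A B (L ** X)) \<le> ereal (1 / sqrt \<kappa>)"
    unfolding Hinf_norm_def closed_loop_transfer_def
    using onorm_transfer_le[OF X \<kappa>(1) _ diss] by (intro SUP_least) simp
  also have "1 / \<gamma> < sqrt \<kappa>" using \<kappa>(2) by (rule real_less_rsqrt)
  then have "ereal (1 / sqrt \<kappa>) < ereal \<gamma>"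
    using \<gamma> \<kappa>(1) by (simp add: field_simps)
  finally show "Hinf_norm (closed_loop_transfer C D A B (L ** matrix_inv Y)) < ereal \<gamma>"
    by (simp add: X_def)
qed

lemma sym_mat_Q_mat:
  assumes "sym_mat \<phi>"
  shows "sym_mat (Q_mat u x \<phi> \<Phi>)"
proof -
  have Q22: "sym_mat (Q22_mat u x \<phi>)"
    using assms by (simp add: Q22_mat_def sym_mat_def matrix_transpose_mul matrix_mul_assoc)
  then have "transpose (pseudoinverse (Q22_mat u x \<phi>)) = pseudoinverse (Q22_mat u x \<phi>)"
    using sym_mat_pseudoinverse by (auto simp: sym_mat_def)
  with Q22 show ?thesis
    unfolding Q_mat_def Let_def
    by (simp add: sym_mat_def transpose_block_mat transpose_add transpose_scaleR matrix_transpose_mul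
        matrix_mul_assoc)
qed

theorem theorem6:
  fixes u :: "nat \<Rightarrow> real^'m"
    and x :: "nat \<Rightarrow> real^'n"
    and \<Phi> :: "real^(1 + 't \<times> 'n)^(1 + ('t::{finite,linorder}) \<times> 'n)"
    and \<phi> :: "real^('t::{finite,linorder})^('t::{finite,linorder})"
    and A\<^sub>s :: "real^'n^'n"
    and B\<^sub>s :: "real^'m^'n"
    and \<gamma> :: real
    and C :: "real^'n^'p"
    and D :: "real^'m^'p"
  assumes "\<Phi> \<in> Pi_set"
    and "sym_mat \<phi>"
    and "blk22 \<Phi> = kronecker \<phi> (mat 1 :: real^'n^'n)"
    and "(A\<^sub>s, B\<^sub>s) \<in> compatible_systems u x (noise_set \<Phi>)"
    and "\<gamma> > 0"
  shows "(informative u x (noise_set \<Phi>) (Theta_Hinf C D) (M_Hinf \<gamma> C D) \<longleftrightarrow>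
           (\<exists>Y L \<alpha> \<beta>. sym_mat Y \<and> \<alpha> \<ge> 0 \<and> \<beta> > 0 \<and>
              pos_semidef (LMI_mat \<gamma> C D (Q_mat u x \<phi> \<Phi>) Y L \<alpha> \<beta>) \<and>
              pos_def (block_mat Y (transpose (C_YL C D Y L)) (C_YL C D Y L) (mat 1)))) \<and>
         (\<forall>Y L \<alpha> \<beta>. sym_mat Y \<and> \<alpha> \<ge> 0 \<and> \<beta> > 0 \<and>
              pos_semidef (LMI_mat \<gamma> C D (Q_mat u x \<phi> \<Phi>) Y L \<alpha> \<beta>) \<and>
              pos_def (block_mat Y (transpose (C_YL C D Y L)) (C_YL C D Y L) (mat 1)) \<longrightarrow>
            (let K = L ** matrix_inv Y in
              \<forall>(A, B)\<in>compatible_systems u x (noise_set \<Phi>).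
                stable_mat (A + B ** K) \<and>
                Hinf_norm (closed_loop_transfer C D A B K) < ereal \<gamma>))"
proof -
  let ?Q = "Q_mat u x \<phi> \<Phi>"
  let ?\<Sigma> = "compatible_systems u x (noise_set \<Phi>)"
  have symQ: "sym_mat ?Q" by (rule sym_mat_Q_mat[OF assms(2)])
  obtain Z\<^sub>0 R s where R: "pos_semidef R"
    and \<Sigma>: "\<And>A B. (A, B) \<in> ?\<Sigma> \<longleftrightarrow> (beside A B - Z\<^sub>0) \<bullet> ((beside A B - Z\<^sub>0) ** R) \<le> s"
    and Q: "\<And>v y. vjoin v y \<bullet> (?Q *v vjoin v y) =
       s * (v \<bullet> v) - (y - transpose Z\<^sub>0 *v v) \<bullet> (R *v (y - transpose Z\<^sub>0 *v v))"
    by (rule data_ellipsoid[OF assms(1-3), of u x]) (rule that)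
  \<comment> \<open>From here on systems are replaced by the vectors y they produce at v. The case v
    = 0 is excluded, since there every system produces y = 0.\<close>
  have images: "(\<exists>A B. (A, B) \<in> ?\<Sigma> \<and> transpose (beside A B) *v v = y) \<longleftrightarrow>
      vjoin v y \<bullet> (?Q *v vjoin v y) \<ge> 0" if "v \<noteq> 0" for v y
  proof -
    have "(\<exists>A B. (A, B) \<in> ?\<Sigma> \<and> transpose (beside A B) *v v = y) \<longleftrightarrow>
      (\<exists>Z. (Z - Z\<^sub>0) \<bullet> ((Z - Z\<^sub>0) ** R) \<le> s \<and> transpose Z *v v = y)"
    proof
      assume "\<exists>Z. (Z - Z\<^sub>0) \<bullet> ((Z - Z\<^sub>0) ** R) \<le> s \<and> transpose Z *v v = y"
      then obtain Z where Z: "(Z - Z\<^sub>0) \<bullet> ((Z - Z\<^sub>0) ** R) \<le> s" "transpose Z *v v = y" by blast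
      obtain A B where "Z = beside A B" by (rule beside_cases)
      with Z show "\<exists>A B. (A, B) \<in> ?\<Sigma> \<and> transpose (beside A B) *v v = y" unfolding \<Sigma> by blast
    qed (unfold \<Sigma>, blast)
    then show ?thesis
      unfolding compatible_images[OF R that] Q by simp
  qed
  \<comment> \<open>The true system makes the ellipsoid nonempty, and a semidefinite form cannot be
    bounded by a negative radius.\<close>
  have s: "s \<ge> 0"
  proof -
    obtain v :: "real^'n" where v: "v \<noteq> 0" using one_neq_zero by blast
    have "0 \<le> vjoin v (transpose (beside A\<^sub>s B\<^sub>s) *v v) \<bullet> (?Q *v vjoin v (transpose (beside A\<^sub>s B\<^sub>s) *v v))"
      using images[OF v] assms(4) by blast
    moreover have "0 \<le> e \<bullet> (R *v e)" for e using R by (simp add: pos_semidef_def)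
    ultimately have "0 \<le> s * (v \<bullet> v)" unfolding Q by (meson diff_ge_0_iff_ge order_trans)
    then show ?thesis using v by (metis inner_gt_zero_iff mult_neg_pos not_less)
  qed
  define form where "form Y L v y = vjoin v y \<bullet> (M_Hinf \<gamma> C D (Y, L) *v vjoin v y)" for Y L v y
  define quad where "quad v y = vjoin v y \<bullet> (?Q *v vjoin v y)" for v y
  have \<Theta>: "(Y, L) \<in> Theta_Hinf C D \<longleftrightarrow> sym_mat Y \<and>
      pos_def (block_mat Y (transpose (C_YL C D Y L)) (C_YL C D Y L) (mat 1))" for Y L
    using pos_def_block_identity_iff by (auto simp: Theta_Hinf_def)
  have lmi: "pos_semidef (LMI_mat \<gamma> C D ?Q Y L \<alpha> \<beta>) \<longleftrightarrow>
      (\<forall>v y. \<alpha> * quad v y + \<beta> * (v \<bullet> v) \<le> form Y L v y)" if "(Y, L) \<in> Theta_Hinf C D" for Y L \<alpha> \<beta>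
    using that pos_semidef_LMI_mat_iff[OF _ symQ, of Y C D L \<gamma> \<alpha> \<beta>] by (simp add: Theta_Hinf_def form_def quad_def)
  have inf: "informative u x (noise_set \<Phi>) (Theta_Hinf C D) (M_Hinf \<gamma> C D) \<longleftrightarrow>
      (\<exists>Y L. (Y, L) \<in> Theta_Hinf C D \<and> (\<forall>v y. v \<noteq> 0 \<longrightarrow> quad v y \<ge> 0 \<longrightarrow> form Y L v y > 0))"
  proof -
    have "(\<forall>(A, B)\<in>?\<Sigma>. \<forall>v. v \<noteq> 0 \<longrightarrow> form Y L v (transpose (beside A B) *v v) > 0) \<longleftrightarrow>
        (\<forall>v y. v \<noteq> 0 \<longrightarrow> quad v y \<ge> 0 \<longrightarrow> form Y L v y > 0)" for Y L
    proof (intro iffI allI impI, goal_cases)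
      case (1 v y)
      then obtain A B where "(A, B) \<in> ?\<Sigma>" "transpose (beside A B) *v v = y"
        using images unfolding quad_def by blast
      with 1 show ?case by blast
    next
      case 2
      show ?case
      proof (clarify)
        fix A B v assume "(A, B) \<in> ?\<Sigma>" "v \<noteq> (0 :: real^'n)"
        then have "quad v (transpose (beside A B) *v v) \<ge> 0"
          using images unfolding quad_def by blast
        with 2 \<open>v \<noteq> 0\<close> show "form Y L v (transpose (beside A B) *v v) > 0" by blast
      qed
    qed
    then show ?thesis
      unfolding informative_form_iff form_def by simp
  qed
  have multiplier: "\<exists>\<alpha> \<beta>. \<alpha> \<ge> 0 \<and> \<beta> > 0 \<and> (\<forall>v y. \<alpha> * quad v y + \<beta> * (v \<bullet> v) \<le> form Y L v y)"
    if YL: "(Y, L) \<in> Theta_Hinf C D" and pos: "\<forall>v y. v \<noteq> 0 \<longrightarrow> quad v y \<ge> 0 \<longrightarrow> form Y L v y > 0" for Y L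
  proof -
    let ?M = "M_Hinf \<gamma> C D (Y, L)"
    let ?P = "Y - transpose (C_YL C D Y L) ** C_YL C D Y L"
    let ?S = "stack Y L"
    have Y: "sym_mat Y" and P: "pos_def ?P" using YL by (auto simp: Theta_Hinf_def)
    have K: "pos_semidef (?S ** matrix_inv ?P ** transpose ?S)"
      using pos_def_matrix_inv[OF P] by (rule pos_semidef_congruence)
    have M: "?M = block_mat (Y - (1 / \<gamma>\<^sup>2) *\<^sub>R mat 1) 0 0 (- (?S ** matrix_inv ?P ** transpose ?S))"
      by (simp add: M_Hinf_def)
    have symM: "sym_mat ?M"
      using K Y unfolding M sym_mat_block_mat
      by (simp add: pos_semidef_def sym_mat_def transpose_diff transpose_scaleR transpose_minus)
    have form': "vjoin v y \<bullet> (?M *v vjoin v y) = v \<bullet> ((Y - (1 / \<gamma>\<^sup>2) *\<^sub>R mat 1) *v v)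
        - y \<bullet> ((?S ** matrix_inv ?P ** transpose ?S) *v y)" for v y
      unfolding M block_mat_mult_vjoin inner_vjoin matrix_minus_mult_vec by simp
    have "vjoin v y \<bullet> (?M *v vjoin v y) > 0"
      if "v \<noteq> 0" "vjoin v y \<bullet> (?Q *v vjoin v y) \<ge> 0" for v y
      using pos that unfolding form_def quad_def by blast
    from multiplier_exists[OF K R s form' symM Q symQ this] obtain \<alpha> \<beta> where "\<alpha> \<ge> 0" "\<beta> > 0"
      "\<And>v y. \<alpha> * (vjoin v y \<bullet> (?Q *v vjoin v y)) + \<beta> * (v \<bullet> v) \<le> vjoin v y \<bullet> (?M *v vjoin v y)"
      by blast
    then show ?thesis unfolding form_def quad_def by blast
  qed
  show ?thesis
  proof (intro conjI allI impI, goal_cases)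
    case 1
    show ?case
    proof
      assume "informative u x (noise_set \<Phi>) (Theta_Hinf C D) (M_Hinf \<gamma> C D)"
      then obtain Y L where YL: "(Y, L) \<in> Theta_Hinf C D"
        and pos: "\<forall>v y. v \<noteq> 0 \<longrightarrow> quad v y \<ge> 0 \<longrightarrow> form Y L v y > 0"
        unfolding inf by blast
      from multiplier[OF YL pos] show "\<exists>Y L \<alpha> \<beta>. sym_mat Y \<and> \<alpha> \<ge> 0 \<and> \<beta> > 0 \<and>
          pos_semidef (LMI_mat \<gamma> C D ?Q Y L \<alpha> \<beta>) \<and>
          pos_def (block_mat Y (transpose (C_YL C D Y L)) (C_YL C D Y L) (mat 1))"
        using YL unfolding lmi[OF YL, symmetric] \<Theta> by blast
    next
      assume "\<exists>Y L \<alpha> \<beta>. sym_mat Y \<and> \<alpha> \<ge> 0 \<and> \<beta> > 0 \<and>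
          pos_semidef (LMI_mat \<gamma> C D ?Q Y L \<alpha> \<beta>) \<and>
          pos_def (block_mat Y (transpose (C_YL C D Y L)) (C_YL C D Y L) (mat 1))"
      then obtain Y L \<alpha> \<beta> where YL: "(Y, L) \<in> Theta_Hinf C D" and \<alpha>: "\<alpha> \<ge> 0" and \<beta>: "\<beta> > 0"
        and LMI: "pos_semidef (LMI_mat \<gamma> C D ?Q Y L \<alpha> \<beta>)"
        unfolding \<Theta> by blast
      have "form Y L v y > 0" if "v \<noteq> 0" "quad v y \<ge> 0" for v y
      proof -
        have "0 < \<alpha> * quad v y + \<beta> * (v \<bullet> v)"
          using \<alpha> \<beta> that by (intro add_nonneg_pos) simp_all
        also have "\<dots> \<le> form Y L v y" using LMI unfolding lmi[OF YL] by blast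
        finally show ?thesis .
      qed
      with YL show "informative u x (noise_set \<Phi>) (Theta_Hinf C D) (M_Hinf \<gamma> C D)"
        unfolding inf by blast
    qed
  next
    case (2 Y L \<alpha> \<beta>)
    then have YL: "(Y, L) \<in> Theta_Hinf C D" and \<alpha>: "\<alpha> \<ge> 0" and \<beta>: "\<beta> > 0"
      and LMI: "pos_semidef (LMI_mat \<gamma> C D ?Q Y L \<alpha> \<beta>)"
      and B: "pos_def (block_mat Y (transpose (C_YL C D Y L)) (C_YL C D Y L) (mat 1))"
      unfolding \<Theta> by blast+
    \<comment> \<open>The form of the block matrix at q = 0 is that of \<open>Y\<close>; this makes
      the gain L Y^-1 meaningful.\<close>
    have Y: "pos_def Y"
    proof -
      have "w \<bullet> (Y *v w) > 0" if "w \<noteq> 0" for w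
      proof -
        have "vjoin w 0 \<bullet> (block_mat Y (transpose (C_YL C D Y L)) (C_YL C D Y L) (mat 1) *v vjoin w 0) > 0"
          using B that by (simp add: pos_def_def vjoin_eq_0_iff)
        then show ?thesis by (simp add: block_mat_mult_vjoin)
      qed
      then show ?thesis using 2 by (simp add: pos_def_def)
    qed
    have "stable_mat (A + B ** (L ** matrix_inv Y)) \<and>
        Hinf_norm (closed_loop_transfer C D A B (L ** matrix_inv Y)) < ereal \<gamma>"
      if AB: "(A, B) \<in> ?\<Sigma>" for A B
    proof -
      have "\<beta> * (v \<bullet> v) \<le> form Y L v (transpose (beside A B) *v v)" for v
      proof (cases "v = 0")
        case True
        then show ?thesis by (simp add: form_def)
      next
        case False
        then have "quad v (transpose (beside A B) *v v) \<ge> 0"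
          using images AB unfolding quad_def by blast
        then have "\<beta> * (v \<bullet> v) \<le> \<alpha> * quad v (transpose (beside A B) *v v) + \<beta> * (v \<bullet> v)"
          using \<alpha> by simp
        also have "\<dots> \<le> form Y L v (transpose (beside A B) *v v)"
          using LMI unfolding lmi[OF YL] by blast
        finally show ?thesis .
      qed
      from Hinf_norm_less[OF Y assms(5) \<beta> _ this[unfolded form_def]] show ?thesis
        using YL by (simp add: Theta_Hinf_def)
    qed
    then show ?case by (auto simp: Let_def)
  qed
qed

end
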